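(* Let $\mathcal{X},\mathcal{Y}$ be real finite dimensional Euclidean spaces, $\mathcal{A}:\mathcal{X}\to\mathcal{Y}$ a linear map with adjoint $\mathcal{A}^*$, $c\in\mathcal{X}$, and let $h:\mathcal{Y}\to\mathbb{R}$ and $p:\mathcal{X}\to(-\infty,+\infty]$ be closed proper convex functions with Fenchel conjugates $h^*$ and $p^*$. Assume that: (i) $h^*$ is essentially smooth, and $\nabla h^*$ is locally Lipschitz continuous and directionally differentiable on $\mathrm{int}(\mathrm{dom}\,h^* )$; (ii) there is a nonempty polyhedral convex set $P\subseteq\mathcal{X}$ such that $p^*$ is either the indicator function $\delta_P$ or the support function $\delta_P^*$ of $P$. Assume that the KKT system $$0=\nabla h^*(y)-\mathcal{A}x,\qquad 0\in -x+\partial p^*(z),\qquad 0=\mathcal{A}^*y+z-c,\qquad (x,y,z)\in\mathcal{X}\times\mathrm{int}(\mathrm{dom}\,h^* )\times\mathcal{X}$$ has at least one solution, denoted $(\bar x,\bar y,\bar z)$, and that the second order sufficient condition for the problem $$\min\{h^*(y)+p^*(z)\mid \mathcal{A}^*y+z=c\}$$ holds at $(\bar y,\bar z)$. Then the multivalued mapping $\mathcal{T}_l:\mathcal{Y}\times\mathcal{X}\times\mathcal{X}\rightrightarrows\mathcal{Y}\times\mathcal{X}\times\mathcal{X}$ is metrically subregular at $(\bar y,\bar z,\bar x)$ for the origin (that is, with some modulus $\kappa\ge 0$).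
   Context: Essential smoothness: a proper convex function $g$ is essentially smooth if $g$ is differentiable on $\mathrm{int}(\mathrm{dom}\,g)\neq\emptyset$ and $\lim_{k\to\infty}\|\nabla g(x^k)\|=+\infty$ whenever $\{x^k\}\subset\mathrm{int}(\mathrm{dom}\,g)$ converges to a boundary point of $\mathrm{int}(\mathrm{dom}\,g)$. Lagrangian and $\mathcal{T}_l$: the Lagrangian is the convex-concave function $l(y,z,x)=h^*(y)+p^*(z)-\langle x,\mathcal{A}^*y+z-c\rangle$ on $\mathcal{Y}\times\mathcal{X}\times\mathcal{X}$, and $\mathcal{T}_l(y,z,x)=\{(y',z',x')\mid (y',z',-x')\in\partial l(y,z,x)\}$, where $\partial l$ consists of the subgradients of $l$ in the convex variables $(y,z)$ paired with the supergradients of $l$ in the concave variable $x$. Explicitly, $$\mathcal{T}_l(y,z,x)=\big(\partial h^*(y)-\mathcal{A}x\big)\times\big(\partial p^*(z)-x\big)\times\{\mathcal{A}^*y+z-c\}.$$ Critical cone at an optimal solution $(\bar y,\bar z)$ of $\min\{h^*(y)+p^*(z)\mid\mathcal{A}^*y+z=c\}$: $$\mathcal{C}(\bar y,\bar z)=\{(d_1,d_2)\in\mathcal{Y}\times\mathcal{X}\mid \mathcal{A}^*d_1+d_2=0,\ \langle\nabla h^*(\bar y),d_1\rangle+(p^* )'(\bar z;d_2)=0,\ d_2\in\mathcal{T}_{\mathrm{dom}(p^* )}(\bar z)\},$$ where $(p^* )'(\bar z;d_2)$ is the directional derivative of $p^*$ at $\bar z$ along $d_2$ and $\mathcal{T}_{\mathrm{dom}(p^*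 )}(\bar z)$ is the tangent cone of $\mathrm{dom}(p^* )$ at $\bar z$. Second order sufficient condition at $(\bar y,\bar z)$ (an optimal solution whose set of Lagrange multipliers is nonempty): $\langle d_1,(\nabla h^* )'(\bar y;d_1)\rangle>0$ for all $0\neq(d_1,d_2)\in\mathcal{C}(\bar y,\bar z)$, where $(\nabla h^* )'(\bar y;d_1)$ is the directional derivative of $\nabla h^*$. Metric subregularity: for a multivalued mapping $F$ between Euclidean spaces and $(\bar u,\bar v)$ in the graph of $F$, $F$ is metrically subregular at $\bar u$ for $\bar v$ with modulus $\kappa\ge0$ if there exist neighborhoods $U$ of $\bar u$ and $V$ of $\bar v$ such that $\mathrm{dist}(u,F^{-1}(\bar v))\le\kappa\,\mathrm{dist}(\bar v,F(u)\cap V)$ for all $u\in U$, where $\mathrm{dist}(u,C)=\inf_{u'\in C}\|u-u'\|$ (equal to $+\infty$ if $C=\emptyset$) and $F^{-1}(v)=\{u\mid v\in F(u)\}$. *)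

theory Defs
  imports "HOL-Analysis.Analysis"
begin

section \<open>Extended-real-valued convex functions\<close>

definition edom :: "('a \<Rightarrow> ereal) \<Rightarrow> 'a set" where
  "edom f = {x. f x < \<infinity>}"

definition eproper :: "('a \<Rightarrow> ereal) \<Rightarrow> bool" where
  "eproper f \<longleftrightarrow> (\<forall>x. f x \<noteq> -\<infinity>) \<and> edom f \<noteq> {}"

definition eepigraph :: "('a \<Rightarrow> ereal) \<Rightarrow> ('a \<times> real) set" where
  "eepigraph f = {(x, t). f x \<le> ereal t}"

definition proper_convex :: "('a::real_normed_vector \<Rightarrow> ereal) \<Rightarrow> bool" where
  "proper_convex f \<longleftrightarrow> eproper f \<and> convex (eepigraph f)"

definition closed_proper_convex :: "('a::real_normed_vector \<Rightarrow> ereal) \<Rightarrow> bool" where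
  "closed_proper_convex f \<longleftrightarrow> proper_convex f \<and> closed (eepigraph f)"

definition fenchel_conjugate :: "('a::real_inner \<Rightarrow> ereal) \<Rightarrow> 'a \<Rightarrow> ereal" where
  "fenchel_conjugate f y = (SUP x. ereal (y \<bullet> x) - f x)"

definition indicator_fn :: "'a set \<Rightarrow> 'a \<Rightarrow> ereal" where
  "indicator_fn P x = (if x \<in> P then 0 else \<infinity>)"

definition support_fn :: "'a::real_inner set \<Rightarrow> 'a \<Rightarrow> ereal" where
  "support_fn P x = (SUP u\<in>P. ereal (x \<bullet> u))"

definition subdifferential :: "('a::real_inner \<Rightarrow> ereal) \<Rightarrow> 'a \<Rightarrow> 'a set" where
  "subdifferential f x = {v. \<forall>w. f x + ereal (v \<bullet> (w - x)) \<le> f w}"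

definition superdifferential :: "('a::real_inner \<Rightarrow> ereal) \<Rightarrow> 'a \<Rightarrow> 'a set" where
  "superdifferential f x = {v. \<forall>w. f w \<le> f x + ereal (v \<bullet> (w - x))}"


section \<open>Derivatives\<close>

(* Only meaningful at interior points of the effective domain: elsewhere the truncation
   real_of_ereal turns infinite values into 0. *)
definition egrad :: "('a::real_inner \<Rightarrow> ereal) \<Rightarrow> 'a \<Rightarrow> 'a" where
  "egrad f x = (THE D. GDERIV (\<lambda>u. real_of_ereal (f u)) x :> D)"

definition essentially_smooth :: "('a::real_inner \<Rightarrow> ereal) \<Rightarrow> bool" where
  "essentially_smooth f \<longleftrightarrow>
     proper_convex f \<and>
     interior (edom f) \<noteq> {} \<and>
     (\<forall>x\<in>interior (edom f). (\<lambda>u. real_of_ereal (f u)) differentiable (at x)) \<and>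
     (\<forall>(X :: nat \<Rightarrow> 'a) a. (\<forall>k. X k \<in> interior (edom f)) \<and> X \<longlonglongrightarrow> a \<and>
          a \<in> frontier (interior (edom f)) \<longrightarrow>
        filterlim (\<lambda>k. norm (egrad f (X k))) at_top sequentially)"

definition locally_lipschitz_on :: "'a::metric_space set \<Rightarrow> ('a \<Rightarrow> 'b::metric_space) \<Rightarrow> bool" where
  "locally_lipschitz_on S F \<longleftrightarrow> (\<forall>x\<in>S. \<exists>e>0. \<exists>L. L-lipschitz_on (ball x e \<inter> S) F)"

definition has_dir_deriv ::
    "('a::real_normed_vector \<Rightarrow> 'b::real_normed_vector) \<Rightarrow> 'a \<Rightarrow> 'a \<Rightarrow> 'b \<Rightarrow> bool" where
  "has_dir_deriv F x d D \<longleftrightarrow> ((\<lambda>t. (F (x + t *\<^sub>R d) - F x) /\<^sub>R t) \<longlongrightarrow> D) (at_right 0)"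

definition dir_differentiable_on ::
    "('a::real_normed_vector \<Rightarrow> 'b::real_normed_vector) \<Rightarrow> 'a set \<Rightarrow> bool" where
  "dir_differentiable_on F S \<longleftrightarrow> (\<forall>x\<in>S. \<forall>d. \<exists>D. has_dir_deriv F x d D)"

definition dir_deriv ::
    "('a::real_normed_vector \<Rightarrow> 'b::real_normed_vector) \<Rightarrow> 'a \<Rightarrow> 'a \<Rightarrow> 'b" where
  "dir_deriv F x d = (THE D. has_dir_deriv F x d D)"

(* One-sided directional derivative of an extended-real-valued function, with values in ereal;
   used at points where f is finite. *)
definition edir_deriv :: "('a::real_vector \<Rightarrow> ereal) \<Rightarrow> 'a \<Rightarrow> 'a \<Rightarrow> ereal" where
  "edir_deriv f x d = Lim (at_right 0) (\<lambda>t. (f (x + t *\<^sub>R d) - f x) / ereal t)"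

definition tangent_cone :: "'a::real_normed_vector set \<Rightarrow> 'a \<Rightarrow> 'a set" where
  "tangent_cone C x =
     {d. \<exists>(t :: nat \<Rightarrow> real) e. (\<forall>k. t k > 0) \<and> t \<longlonglongrightarrow> 0 \<and> e \<longlonglongrightarrow> d \<and>
           (\<forall>k. x + t k *\<^sub>R e k \<in> C)}"


section \<open>Metric subregularity\<close>

(* Unlike infdist, this is \<infinity> for the empty set. *)
definition esetdist :: "'a::metric_space \<Rightarrow> 'a set \<Rightarrow> ereal" where
  "esetdist u C = (INF w\<in>C. ereal (dist u w))"

definition set_inverse :: "('a \<Rightarrow> 'b set) \<Rightarrow> 'b \<Rightarrow> 'a set" where
  "set_inverse F v = {u. v \<in> F u}"

(* The product 0 * \<infinity> is 0 in ereal, so modulus 0 is read in the more demanding way;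
   this does not affect the existence of a modulus. *)
definition metrically_subregular ::
    "('a::metric_space \<Rightarrow> 'b::metric_space set) \<Rightarrow> 'a \<Rightarrow> 'b \<Rightarrow> real \<Rightarrow> bool" where
  "metrically_subregular F ubar vbar \<kappa> \<longleftrightarrow>
     \<kappa> \<ge> 0 \<and> vbar \<in> F ubar \<and>
     (\<exists>U V. open U \<and> ubar \<in> U \<and> open V \<and> vbar \<in> V \<and>
        (\<forall>u\<in>U. esetdist u (set_inverse F vbar) \<le> ereal \<kappa> * esetdist vbar (F u \<inter> V)))"


section \<open>The linearly constrained problem\<close>

text \<open>
  Throughout, \<open>hs\<close> and \<open>ps\<close> stand for the conjugates \<open>h\<^sup>*\<close> and \<open>p\<^sup>*\<close>; the problem is to minimise
  \<open>hs y + ps z\<close> subject to \<open>adjoint A y + z = c\<close>.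
\<close>

definition lagrangian ::
    "('y::euclidean_space \<Rightarrow> ereal) \<Rightarrow> ('x::euclidean_space \<Rightarrow> ereal) \<Rightarrow> ('x \<Rightarrow> 'y) \<Rightarrow> 'x \<Rightarrow>
     'y \<Rightarrow> 'x \<Rightarrow> 'x \<Rightarrow> ereal" where
  "lagrangian hs ps A c y z x = hs y + ps z - ereal (x \<bullet> (adjoint A y + z - c))"

definition lagrangian_map ::
    "('y::euclidean_space \<Rightarrow> ereal) \<Rightarrow> ('x::euclidean_space \<Rightarrow> ereal) \<Rightarrow> ('x \<Rightarrow> 'y) \<Rightarrow> 'x \<Rightarrow>
     'y \<times> 'x \<times> 'x \<Rightarrow> ('y \<times> 'x \<times> 'x) set" where
  "lagrangian_map hs ps A c = (\<lambda>(y, z, x). {(y', z', x').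
     (y', z') \<in> subdifferential (\<lambda>(v, w). lagrangian hs ps A c v w x) (y, z) \<and>
     - x' \<in> superdifferential (\<lambda>u. lagrangian hs ps A c y z u) x})"

definition kkt_point ::
    "('y::euclidean_space \<Rightarrow> ereal) \<Rightarrow> ('x::euclidean_space \<Rightarrow> ereal) \<Rightarrow> ('x \<Rightarrow> 'y) \<Rightarrow> 'x \<Rightarrow>
     'x \<Rightarrow> 'y \<Rightarrow> 'x \<Rightarrow> bool" where
  "kkt_point hs ps A c x y z \<longleftrightarrow>
     y \<in> interior (edom hs) \<and>
     0 = egrad hs y - A x \<and>
     0 \<in> (\<lambda>v. - x + v) ` subdifferential ps z \<and>
     0 = adjoint A y + z - c"

definition optimal_solution ::
    "('y::euclidean_space \<Rightarrow> ereal) \<Rightarrow> ('x::euclidean_space \<Rightarrow> ereal) \<Rightarrow> ('x \<Rightarrow> 'y) \<Rightarrow> 'x \<Rightarrow>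
     'y \<Rightarrow> 'x \<Rightarrow> bool" where
  "optimal_solution hs ps A c y z \<longleftrightarrow>
     y \<in> edom hs \<and> z \<in> edom ps \<and> adjoint A y + z = c \<and>
     (\<forall>v w. adjoint A v + w = c \<longrightarrow> hs y + ps z \<le> hs v + ps w)"

definition lagrange_multipliers ::
    "('y::euclidean_space \<Rightarrow> ereal) \<Rightarrow> ('x::euclidean_space \<Rightarrow> ereal) \<Rightarrow> ('x \<Rightarrow> 'y) \<Rightarrow> 'x \<Rightarrow>
     'y \<Rightarrow> 'x \<Rightarrow> 'x set" where
  "lagrange_multipliers hs ps A c y z = {x. kkt_point hs ps A c x y z}"

definition critical_cone ::
    "('y::euclidean_space \<Rightarrow> ereal) \<Rightarrow> ('x::euclidean_space \<Rightarrow> ereal) \<Rightarrow> ('x \<Rightarrow> 'y) \<Rightarrow>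
     'y \<Rightarrow> 'x \<Rightarrow> ('y \<times> 'x) set" where
  "critical_cone hs ps A y z =
     {(d1, d2). adjoint A d1 + d2 = 0 \<and>
                ereal (egrad hs y \<bullet> d1) + edir_deriv ps z d2 = 0 \<and>
                d2 \<in> tangent_cone (edom ps) z}"

(* The first two conjuncts are the standing requirements on the reference point. They follow
   from any KKT point over it, see kkt_point_optimal below. *)
definition second_order_sufficient ::
    "('y::euclidean_space \<Rightarrow> ereal) \<Rightarrow> ('x::euclidean_space \<Rightarrow> ereal) \<Rightarrow> ('x \<Rightarrow> 'y) \<Rightarrow> 'x \<Rightarrow>
     'y \<Rightarrow> 'x \<Rightarrow> bool" where
  "second_order_sufficient hs ps A c y z \<longleftrightarrow>
     optimal_solution hs ps A c y z \<and>
     lagrange_multipliers hs ps A c y z \<noteq> {} \<and>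
     (\<forall>d1 d2. (d1, d2) \<in> critical_cone hs ps A y z \<and> (d1, d2) \<noteq> 0 \<longrightarrow>
        d1 \<bullet> dir_deriv (egrad hs) y d1 > 0)"


section \<open>Consistency checks\<close>

lemma subdifferential_dom:
  assumes "eproper f" "v \<in> subdifferential f x"
  shows "x \<in> edom f"
proof -
  obtain w where w: "f w < \<infinity>" using assms(1) by (auto simp: eproper_def edom_def)
  have "f x + ereal (v \<bullet> (w - x)) \<le> f w" using assms(2) by (simp add: subdifferential_def)
  then show ?thesis using w by (cases "f x") (auto simp: edom_def)
qed

lemma eproper_finite:
  assumes "eproper f" "x \<in> edom f"
  shows "\<exists>r. f x = ereal r"
  using assms by (cases "f x") (auto simp: eproper_def edom_def)

lemma eproper_witness:
  assumes "eproper f"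
  shows "\<exists>x r. f x = ereal r"
proof -
  obtain x where "x \<in> edom f" using assms by (auto simp: eproper_def)
  from eproper_finite[OF assms this] show ?thesis by blast
qed

lemma lagrangian_map_explicit:
  fixes hs :: "'y::euclidean_space \<Rightarrow> ereal" and ps :: "'x::euclidean_space \<Rightarrow> ereal"
    and A :: "'x \<Rightarrow> 'y"
  assumes hs: "eproper hs" and ps: "eproper ps" and A: "linear A"
  shows "lagrangian_map hs ps A c (y, z, x) =
     ((\<lambda>v. v - A x) ` subdifferential hs y) \<times> ((\<lambda>v. v - x) ` subdifferential ps z) \<times>
     {adjoint A y + z - c}"
proof -
  have lin: "linear (adjoint A)" by (rule adjoint_linear[OF A])
  have adj: "x \<bullet> adjoint A u = A x \<bullet> u" for u
    by (simp add: adjoint_works[OF A])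
  have key: "(y', z', x') \<in> lagrangian_map hs ps A c (y, z, x) \<longleftrightarrow>
      y' + A x \<in> subdifferential hs y \<and> z' + x \<in> subdifferential ps z \<and>
      x' = adjoint A y + z - c" (is "?L \<longleftrightarrow> ?R") for y' z' x'
  proof
    assume L: ?L
    have L': "\<forall>q. lagrangian hs ps A c y z x + ereal ((y', z') \<bullet> (q - (y, z)))
        \<le> (case q of (v, w) \<Rightarrow> lagrangian hs ps A c v w x)"
      using L by (simp add: lagrangian_map_def subdifferential_def)
    have sub: "lagrangian hs ps A c y z x + ereal (y' \<bullet> (v - y) + z' \<bullet> (w - z))
        \<le> lagrangian hs ps A c v w x" for v w
      using spec[OF L', of "(v, w)"] by simp
    have sup: "lagrangian hs ps A c y z u
        \<le> lagrangian hs ps A c y z x + ereal (- x' \<bullet> (u - x))" for u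
      using L by (simp add: lagrangian_map_def superdifferential_def)
    obtain v0 a where v0: "hs v0 = ereal a"
      using eproper_witness[OF hs] by blast
    obtain w0 b where w0: "ps w0 = ereal b"
      using eproper_witness[OF ps] by blast
    have ninf: "hs y \<noteq> -\<infinity>" "ps z \<noteq> -\<infinity>" using hs ps by (auto simp: eproper_def)
    obtain r where r: "hs y = ereal r"
      using sub[of v0 w0] v0 w0 ninf
      by (cases "hs y"; cases "ps z") (auto simp: lagrangian_def)
    obtain s where s: "ps z = ereal s"
      using sub[of v0 w0] v0 w0 ninf
      by (cases "hs y"; cases "ps z") (auto simp: lagrangian_def)
    have 1: "hs y + ereal ((y' + A x) \<bullet> (v - y)) \<le> hs v" for v
    proof (cases "hs v")
      case (real q)
      show ?thesis using sub[of v z] r s real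
        by (simp add: lagrangian_def inner_diff_right inner_add_left inner_add_right adj)
    next
      case MInf then show ?thesis using hs by (auto simp: eproper_def)
    qed simp
    have 2: "ps z + ereal ((z' + x) \<bullet> (w - z)) \<le> ps w" for w
    proof (cases "ps w")
      case (real q)
      show ?thesis using sub[of y w] r s real
        by (simp add: lagrangian_def inner_diff_right inner_add_left inner_add_right)
    next
      case MInf then show ?thesis using ps by (auto simp: eproper_def)
    qed simp
    define g where "g = adjoint A y + z - c"
    have "(x' - g) \<bullet> (u - x) \<le> 0" for u
      using sup[of u] r s unfolding lagrangian_def g_def[symmetric]
      by (simp add: inner_diff_right inner_diff_left inner_commute)
    from this[of "x + (x' - g)"] have "(x' - g) \<bullet> (x' - g) \<le> 0"
      by simp
    then have "x' = g" by (metis inner_ge_zero inner_eq_zero_iff order_antisym eq_iff_diff_eq_0)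
    then show ?R using 1 2 by (simp add: subdifferential_def g_def)
  next
    assume R: ?R
    obtain r where r: "hs y = ereal r"
      using R eproper_finite[OF hs subdifferential_dom[OF hs]] by blast
    obtain s where s: "ps z = ereal s"
      using R eproper_finite[OF ps subdifferential_dom[OF ps]] by blast
    have 1: "hs y + ereal ((y' + A x) \<bullet> (v - y)) \<le> hs v" for v
      using R by (simp add: subdifferential_def)
    have 2: "ps z + ereal ((z' + x) \<bullet> (w - z)) \<le> ps w" for w
      using R by (simp add: subdifferential_def)
    have sub: "lagrangian hs ps A c y z x + ereal (y' \<bullet> (v - y) + z' \<bullet> (w - z))
        \<le> lagrangian hs ps A c v w x" for v w
      using 1[of v] 2[of w] r s
      by (cases "hs v"; cases "ps w")
         (auto simp: lagrangian_def inner_diff_right inner_add_left inner_add_right adj)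
    have sup: "lagrangian hs ps A c y z u
        \<le> lagrangian hs ps A c y z x + ereal (- x' \<bullet> (u - x))" for u
      using R r s
      by (simp add: lagrangian_def inner_diff_right inner_diff_left inner_add_left
          inner_add_right inner_commute)
    show ?L using sub sup
      by (auto simp: lagrangian_map_def subdifferential_def superdifferential_def)
  qed
  show ?thesis
  proof (rule set_eqI)
    fix q :: "'y \<times> 'x \<times> 'x"
    obtain y' z' x' where q: "q = (y', z', x')" by (cases q) auto
    have i1: "y' \<in> (\<lambda>v. v - A x) ` subdifferential hs y \<longleftrightarrow> y' + A x \<in> subdifferential hs y"
      by (metis (no_types, lifting) add_diff_cancel diff_add_cancel imageE imageI)
    have i2: "z' \<in> (\<lambda>v. v - x) ` subdifferential ps z \<longleftrightarrow> z' + x \<in> subdifferential ps z"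
      by (metis (no_types, lifting) add_diff_cancel diff_add_cancel imageE imageI)
    show "q \<in> lagrangian_map hs ps A c (y, z, x) \<longleftrightarrow>
        q \<in> ((\<lambda>v. v - A x) ` subdifferential hs y) \<times> ((\<lambda>v. v - x) ` subdifferential ps z) \<times>
     {adjoint A y + z - c}"
      unfolding q using key[of y' z' x'] i1 i2 by auto
  qed
qed

lemma GDERIV_egrad:
  fixes f :: "'a::euclidean_space \<Rightarrow> ereal"
  assumes "(\<lambda>u. real_of_ereal (f u)) differentiable (at x)"
  shows "GDERIV (\<lambda>u. real_of_ereal (f u)) x :> egrad f x"
proof -
  let ?f = "\<lambda>u. real_of_ereal (f u)"
  obtain F where F: "(?f has_derivative F) (at x)"
    using assms by (auto simp: differentiable_def)
  interpret F: linear F using F by (rule has_derivative_linear)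
  define D where "D = adjoint F 1"
  have "F h = h \<bullet> D" for h
    using adjoint_works[OF F.linear_axioms, of h 1] by (simp add: D_def inner_commute)
  then have "F = (\<lambda>h. h \<bullet> D)" by auto
  with F have D: "GDERIV ?f x :> D" by (simp add: gderiv_def)
  have uniq: "E = D" if "GDERIV ?f x :> E" for E
  proof -
    have "(\<lambda>h. h \<bullet> E) = (\<lambda>h. h \<bullet> D)"
      using that D unfolding gderiv_def by (rule has_derivative_unique)
    then have "\<forall>h. h \<bullet> E = h \<bullet> D" by (simp add: fun_eq_iff)
    then show ?thesis by (simp only: vector_eq_ldot)
  qed
  show ?thesis unfolding egrad_def by (rule theI[of _ D], rule D, rule uniq)
qed

lemma egrad_subdifferential:
  fixes f :: "'a::euclidean_space \<Rightarrow> ereal"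
  assumes f: "proper_convex f" and x: "x \<in> interior (edom f)"
    and diff: "(\<lambda>u. real_of_ereal (f u)) differentiable (at x)"
  shows "egrad f x \<in> subdifferential f x"
proof -
  let ?f = "\<lambda>u. real_of_ereal (f u)"
  have pr: "eproper f" using f by (simp add: proper_convex_def)
  obtain r where r: "f x = ereal r"
    using eproper_finite[OF pr subsetD[OF interior_subset x]] by blast
  have "f x + ereal (egrad f x \<bullet> (w - x)) \<le> f w" for w
  proof (cases "f w")
    case (real s)
    define \<phi> where "\<phi> = (\<lambda>t::real. ?f (x + t *\<^sub>R (w - x)))"
    have conv: "\<phi> t \<le> (1 - t) * r + t * s" if t: "0 < t" "t \<le> 1" for t
    proof -
      have "(1 - t) *\<^sub>R (x, r) + t *\<^sub>R (w, s) \<in> eepigraph f"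
        using f t r real unfolding proper_convex_def convex_alt
        by (auto simp: eepigraph_def)
      then have le: "f (x + t *\<^sub>R (w - x)) \<le> ereal ((1 - t) * r + t * s)"
        by (simp add: eepigraph_def algebra_simps)
      then show ?thesis using pr unfolding \<phi>_def
        by (cases "f (x + t *\<^sub>R (w - x))") (auto simp: eproper_def)
    qed
    have "(\<phi> has_derivative (\<lambda>t. (t *\<^sub>R (w - x)) \<bullet> egrad f x)) (at 0)"
    proof -
      have g: "(?f has_derivative (\<lambda>h. h \<bullet> egrad f x)) (at (x + 0 *\<^sub>R (w - x)))"
        using GDERIV_egrad[OF diff] by (simp add: gderiv_def)
      have "((\<lambda>t::real. x + t *\<^sub>R (w - x)) has_derivative (\<lambda>t. t *\<^sub>R (w - x))) (at 0)"
        by (auto intro!: derivative_eq_intros)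
      from has_derivative_compose[OF this g] show ?thesis by (simp add: \<phi>_def)
    qed
    then have "(\<phi> has_real_derivative (egrad f x \<bullet> (w - x))) (at 0)"
      by (simp add: has_field_derivative_def inner_commute mult_commute_abs)
    then have "((\<lambda>t. (\<phi> t - \<phi> 0) / t) \<longlongrightarrow> egrad f x \<bullet> (w - x)) (at 0)"
      by (simp add: DERIV_def)
    then have lim: "((\<lambda>t. (\<phi> t - \<phi> 0) / t) \<longlongrightarrow> egrad f x \<bullet> (w - x)) (at_right 0)"
      by (rule filterlim_mono) (auto simp: at_le)
    have "\<phi> 0 = r" by (simp add: \<phi>_def r)
    have "eventually (\<lambda>t::real. t \<in> {0<..<1}) (at_right 0)"
      by (rule eventually_at_right_real) simp
    then have "eventually (\<lambda>t. (\<phi> t - \<phi> 0) / t \<le> s - r) (at_right 0)"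
    proof eventually_elim
      case (elim t)
      then have "\<phi> t - \<phi> 0 \<le> (s - r) * t"
        using conv[of t] \<open>\<phi> 0 = r\<close> by (simp add: algebra_simps)
      then show ?case using elim by (simp add: pos_divide_le_eq)
    qed
    then have "egrad f x \<bullet> (w - x) \<le> s - r"
      using lim by (intro tendsto_upperbound) auto
    then show ?thesis by (simp add: r real)
  next
    case MInf then show ?thesis using pr by (auto simp: eproper_def)
  qed simp
  then show ?thesis by (simp add: subdifferential_def)
qed

lemma kkt_point_optimal:
  fixes hs :: "'y::euclidean_space \<Rightarrow> ereal" and ps :: "'x::euclidean_space \<Rightarrow> ereal"
    and A :: "'x \<Rightarrow> 'y"
  assumes hs: "essentially_smooth hs" and ps: "eproper ps" and A: "linear A"
    and kkt: "kkt_point hs ps A c x y z"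
  shows "optimal_solution hs ps A c y z" "lagrange_multipliers hs ps A c y z \<noteq> {}"
proof -
  have y: "y \<in> interior (edom hs)" and g: "egrad hs y = A x" and feas: "adjoint A y + z = c"
    and xs: "x \<in> subdifferential ps z"
    using kkt by (auto simp: kkt_point_def)
  have pc: "proper_convex hs" and pr: "eproper hs"
    using hs by (auto simp: essentially_smooth_def proper_convex_def)
  have "egrad hs y \<in> subdifferential hs y"
    using hs y by (intro egrad_subdifferential pc) (auto simp: essentially_smooth_def)
  then have 1: "hs y + ereal (A x \<bullet> (v - y)) \<le> hs v" for v
    by (simp add: subdifferential_def g)
  have 2: "ps z + ereal (x \<bullet> (w - z)) \<le> ps w" for w
    using xs by (simp add: subdifferential_def)
  have ydom: "y \<in> edom hs" using y interior_subset by blast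
  have zdom: "z \<in> edom ps" using subdifferential_dom[OF ps xs] .
  obtain r s where rs: "hs y = ereal r" "ps z = ereal s"
    using eproper_finite[OF pr ydom] eproper_finite[OF ps zdom] by blast
  have "hs y + ps z \<le> hs v + ps w" if "adjoint A v + w = c" for v w
  proof -
    have eq: "x \<bullet> (adjoint A v + w) = x \<bullet> (adjoint A y + z)" using that feas by simp
    have "A x \<bullet> (v - y) + x \<bullet> (w - z) = 0"
      using eq by (simp add: inner_diff_right inner_add_right adjoint_works[OF A])
    then show ?thesis using 1[of v] 2[of w] rs
      by (cases "hs v"; cases "ps w") auto
  qed
  then show "optimal_solution hs ps A c y z"
    using ydom zdom feas by (simp add: optimal_solution_def)
  show "lagrange_multipliers hs ps A c y z \<noteq> {}"
    using kkt by (auto simp: lagrange_multipliers_def)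
qed

end

theory Submission
  imports Defs
begin

text \<open>
  Write \<open>F\<close> for the gradient of \<open>h\<^sup>*\<close> and \<open>S\<close> for the subdifferential of \<open>p\<^sup>*\<close>. Near the reference point,
  \<open>(a, b, e)\<close> is a value of the Lagrangian map at \<open>(y, z, x)\<close> iff \<open>F y = A x + a\<close>, \<open>x + b \<in> S z\<close> and
  \<open>adjoint A y + z - c = e\<close>, and it has to be shown that \<open>(y, z, x)\<close> is then within a multiple of
  \<open>norm a + norm b + norm e\<close> of the solution set.

  The dual variable is handled by polyhedrality. The set \<open>M\<close> of multipliers of the reference pair,
  that is of all \<open>p \<in> S z0\<close> with \<open>A p = F y0\<close>, is a polyhedron, and \<open>S z \<subseteq> S z0\<close> for \<open>z\<close> near \<open>z0\<close>.
  Hoffman's error bound then places \<open>x\<close> within a multiple of \<open>norm (y - y0) + norm a + norm b\<close> of \<open>M\<close>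
  (lemma \<open>multiplier_bound\<close>). As \<open>z\<close> is determined by \<open>y\<close> and \<open>e\<close>, everything reduces to bounding
  \<open>norm (y - y0)\<close> by the residual.

  This last bound is obtained by contradiction and compactness (lemmas \<open>no_sublinear_sequence\<close> and
  \<open>primal_bound\<close>). If it fails along a sequence, the normalised displacements of \<open>y\<close> converge to a
  unit vector \<open>d\<close> and those of \<open>z\<close> to \<open>- adjoint A d\<close>. Polyhedrality shows that \<open>(d, - adjoint A d)\<close>
  is a critical direction, so \<open>d \<bullet> D > 0\<close> for the directional derivative \<open>D\<close> of \<open>F\<close> along \<open>d\<close>. On the
  other hand, monotonicity of \<open>S\<close> bounds \<open>(F y - F y0) \<bullet> (y - y0)\<close> from above by
  \<open>norm (x - p) * norm e\<close> plus terms of the order of the residual times \<open>norm (y - y0)\<close>, for any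
  \<open>p \<in> M\<close>. The reference multiplier would not do here, as \<open>x\<close> need not approach it at the rate of
  \<open>y\<close>; but a nearby \<open>p \<in> M\<close> makes the first term of the same order as the others, and after division
  by the square of \<open>norm (y - y0)\<close> the limit is \<open>d \<bullet> D \<le> 0\<close>.

  The polyhedral facts are proved for the map \<open>maximizers P\<close> and its inverse, the subdifferentials of
  the support function and of the indicator function of \<open>P\<close>. Both have polyhedral values and gain no
  values locally (predicate \<open>outer_stable\<close>), because \<open>P\<close> has only finitely many faces.
\<close>

section \<open>Error bounds and tangent directions of polyhedra\<close>

definition linear_solutions :: "('a::euclidean_space \<times> real) set \<Rightarrow> 'a set" where
  "linear_solutions H = {x. \<forall>(a, b)\<in>H. a \<bullet> x \<le> b}"

lemma polyhedron_linear_solutions: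
  assumes "polyhedron Q"
  obtains H where "finite H" "Q = linear_solutions H"
proof -
  obtain F where F: "finite F" "Q = \<Inter>F" "\<forall>h\<in>F. \<exists>a b. a \<noteq> 0 \<and> h = {x. a \<bullet> x \<le> b}"
    using assms by (auto simp: polyhedron_def)
  then obtain a b where ab: "\<And>h. h \<in> F \<Longrightarrow> h = {x. a h \<bullet> x \<le> b h}"
    by metis
  have "Q = linear_solutions ((\<lambda>h. (a h, b h)) ` F)"
    using ab unfolding F(2) linear_solutions_def by auto
  with F(1) show thesis by (intro that) auto
qed

lemma eventually_feasible_direction:
  fixes H :: "('a::euclidean_space \<times> real) set"
  assumes fin: "finite H" and z: "z \<in> linear_solutions H"
    and d: "\<And>a b. (a, b) \<in> H \<Longrightarrow> a \<bullet> z = b \<Longrightarrow> a \<bullet> d \<le> 0"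
  shows "\<forall>\<^sub>F t in at_right 0. z + t *\<^sub>R d \<in> linear_solutions H"
proof -
  have "\<forall>h\<in>H. \<forall>\<^sub>F t in at_right 0. fst h \<bullet> (z + t *\<^sub>R d) \<le> snd h"
  proof
    fix h assume h: "h \<in> H"
    show "\<forall>\<^sub>F t in at_right 0. fst h \<bullet> (z + t *\<^sub>R d) \<le> snd h"
    proof (cases "fst h \<bullet> z = snd h")
      case True
      then have "fst h \<bullet> d \<le> 0" using d[of "fst h" "snd h"] h by simp
      then have le: "\<And>t. t > 0 \<Longrightarrow> fst h \<bullet> (z + t *\<^sub>R d) \<le> snd h"
        using True by (simp add: inner_add_right mult_le_0_iff)
      show ?thesis using eventually_at_right_less by eventually_elim (rule le)
    next
      case False
      then have lt: "fst h \<bullet> z < snd h"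
        using z h by (force simp: linear_solutions_def)
      have "((\<lambda>t. fst h \<bullet> (z + t *\<^sub>R d)) \<longlongrightarrow> fst h \<bullet> (z + 0 *\<^sub>R d)) (at_right 0)"
        by (intro tendsto_intros)
      then have "\<forall>\<^sub>F t in at_right 0. fst h \<bullet> (z + t *\<^sub>R d) < snd h"
        using lt by (intro order_tendstoD(2)[where a="snd h"]) auto
      then show ?thesis by eventually_elim simp
    qed
  qed
  then have "\<forall>\<^sub>F t in at_right 0. \<forall>h\<in>H. fst h \<bullet> (z + t *\<^sub>R d) \<le> snd h"
    using fin by (simp add: eventually_ball_finite)
  then show ?thesis
    by eventually_elim (auto simp: linear_solutions_def)
qed

text \<open>
  A unit vector \<open>v\<close> in the polar of the cone \<open>{u. \<forall>a\<in>K. a \<bullet> u \<le> 0}\<close> cannot belong to that cone,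
  since otherwise \<open>v \<bullet> v \<le> 0\<close>. So it violates some of the inequalities, and by compactness of the
  set of such \<open>v\<close> it does so by a uniform amount. Compactness thus replaces the representation of
  polar vectors by Farkas' lemma.
\<close>

lemma normal_direction_violates_active:
  fixes K :: "'a::euclidean_space set"
  assumes "finite K"
  shows "\<exists>\<epsilon>>0. \<forall>v r. (\<forall>u. (\<forall>a\<in>K. a \<bullet> u \<le> 0) \<longrightarrow> v \<bullet> u \<le> 0) \<longrightarrow> (\<forall>a\<in>K. a \<bullet> v \<le> r)
           \<longrightarrow> 0 \<le> r \<longrightarrow> \<epsilon> * norm v \<le> r"
proof -
  define N where "N = sphere (0::'a) 1 \<inter> (\<Inter>u\<in>{u. \<forall>a\<in>K. a \<bullet> u \<le> 0}. {v. u \<bullet> v \<le> 0})"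
  define g where "g v = (\<Sum>a\<in>K. max 0 (a \<bullet> v))" for v
  have "closed (\<Inter>u\<in>{u. \<forall>a\<in>K. a \<bullet> u \<le> 0}. {v. u \<bullet> v \<le> 0})"
    by (intro closed_INT ballI closed_halfspace_le)
  then have "compact N"
    unfolding N_def by (intro compact_Int_closed compact_sphere)
  have cont: "continuous_on N g"
    unfolding g_def by (intro continuous_intros)
  have pos: "g v > 0" if "v \<in> N" for v
  proof (rule ccontr)
    assume "\<not> g v > 0"
    moreover have "g v \<ge> 0" unfolding g_def by (intro sum_nonneg) auto
    ultimately have "g v = 0" by simp
    then have "\<forall>a\<in>K. max 0 (a \<bullet> v) = 0"
      unfolding g_def using assms by (subst (asm) sum_nonneg_eq_0_iff) auto
    then have "\<forall>a\<in>K. a \<bullet> v \<le> 0" by (metis max.cobounded2)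
    with that have "v \<bullet> v \<le> 0" by (auto simp: N_def)
    then have "v = 0" by (metis inner_ge_zero inner_eq_zero_iff order_antisym)
    then show False using that by (auto simp: N_def)
  qed
  obtain m where m: "m > 0" "\<And>v. v \<in> N \<Longrightarrow> m \<le> g v"
  proof (cases "N = {}")
    case True
    show thesis by (rule that[of 1]) (use True in auto)
  next
    case False
    obtain v0 where "v0 \<in> N" "\<And>v. v \<in> N \<Longrightarrow> g v0 \<le> g v"
      using continuous_attains_inf[OF \<open>compact N\<close> False cont] by blast
    then show thesis using pos that by blast
  qed
  \<comment> \<open>The added \<open>1\<close> keeps \<open>k\<close> positive when \<open>K\<close> is empty.\<close>
  define k where "k = real (card K) + 1"
  have k: "k > 0" by (simp add: k_def)
  have "(m / k) * norm v \<le> r"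
    if polar: "\<forall>u. (\<forall>a\<in>K. a \<bullet> u \<le> 0) \<longrightarrow> v \<bullet> u \<le> 0" and r: "\<forall>a\<in>K. a \<bullet> v \<le> r" "0 \<le> r" for v r
  proof (cases "v = 0")
    case True then show ?thesis using r by simp
  next
    case False
    have "v /\<^sub>R norm v \<in> N"
      using False polar by (auto simp: N_def inner_commute mult_le_0_iff)
    then have "m \<le> g (v /\<^sub>R norm v)" by (rule m)
    also have "\<dots> \<le> (\<Sum>a\<in>K. r / norm v)"
      unfolding g_def using r False
      by (intro sum_mono) (simp add: divide_inverse_commute mult_left_mono)
    also have "\<dots> = real (card K) * (r / norm v)" by simp
    also have "\<dots> \<le> k * (r / norm v)"
      using r(2) by (intro mult_right_mono) (auto simp: k_def)
    finally show ?thesis using False k by (simp add: field_simps)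
  qed
  then show ?thesis using m(1) k by (intro exI[of _ "m / k"]) auto
qed

text \<open>
  Hoffman's error bound. If \<open>p\<close> is the projection of \<open>x\<close>, then \<open>x - p\<close> is nonpositive on the
  cone of feasible directions at \<open>p\<close>, which is cut out by the constraints active at \<open>p\<close>; by the
  previous lemma it must violate one of these by a fixed proportion of its length, and at \<open>x\<close>
  that violation is at most \<open>r\<close>. The proportion depends only on the active set, of which there are
  finitely many, so a uniform constant results.
\<close>

lemma hoffman_bound_inequalities:
  fixes H :: "('a::euclidean_space \<times> real) set"
  assumes fin: "finite H" and ne: "linear_solutions H \<noteq> {}"
  shows "\<exists>\<kappa>\<ge>0. \<forall>x r. 0 \<le> r \<longrightarrow> (\<forall>(a, b)\<in>H. a \<bullet> x \<le> b + r) \<longrightarrow>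
           (\<exists>p\<in>linear_solutions H. dist x p \<le> \<kappa> * r)"
proof -
  define P where "P = linear_solutions H"
  have P: "P = (\<Inter>h\<in>H. {x. fst h \<bullet> x \<le> snd h})"
    by (force simp: P_def linear_solutions_def)
  have "closed P" "convex P"
    unfolding P by (auto intro!: closed_halfspace_le convex_INT convex_halfspace_le)
  have "\<forall>I\<in>Pow H. \<exists>\<epsilon>>0. \<forall>v r. (\<forall>u. (\<forall>a\<in>fst ` I. a \<bullet> u \<le> 0) \<longrightarrow> v \<bullet> u \<le> 0)
           \<longrightarrow> (\<forall>a\<in>fst ` I. a \<bullet> v \<le> r) \<longrightarrow> 0 \<le> r \<longrightarrow> \<epsilon> * norm v \<le> r"
    using fin by (intro ballI normal_direction_violates_active) (auto intro: finite_subset)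
  from bchoice[OF this] obtain \<epsilon> where \<epsilon>: "\<forall>I\<in>Pow H. \<epsilon> I > 0 \<and>
      (\<forall>v r. (\<forall>u. (\<forall>a\<in>fst ` I. a \<bullet> u \<le> 0) \<longrightarrow> v \<bullet> u \<le> 0)
           \<longrightarrow> (\<forall>a\<in>fst ` I. a \<bullet> v \<le> r) \<longrightarrow> 0 \<le> r \<longrightarrow> \<epsilon> I * norm v \<le> r)" ..
  define m where "m = Min (\<epsilon> ` Pow H)"
  have m: "m > 0" "\<And>I. I \<subseteq> H \<Longrightarrow> m \<le> \<epsilon> I"
  proof -
    show "m > 0" using fin \<epsilon> by (subst m_def, subst Min_gr_iff) auto
    show "m \<le> \<epsilon> I" if "I \<subseteq> H" for I using fin that by (simp add: m_def)
  qed
  have "\<exists>p\<in>P. dist x p \<le> (1 / m) * r"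
    if r: "0 \<le> r" "\<forall>(a, b)\<in>H. a \<bullet> x \<le> b + r" for x r
  proof -
    define p where "p = closest_point P x"
    have p: "p \<in> P"
      using ne \<open>closed P\<close> by (auto simp: p_def P_def intro: closest_point_in_set)
    define I where "I = {h\<in>H. fst h \<bullet> p = snd h}"
    have "(x - p) \<bullet> u \<le> 0" if u: "\<forall>a\<in>fst ` I. a \<bullet> u \<le> 0" for u
    proof -
      have "\<forall>\<^sub>F s in at_right 0. p + s *\<^sub>R u \<in> P"
        unfolding P_def
        using fin p u by (intro eventually_feasible_direction) (force simp: I_def P_def)+
      then have "\<forall>\<^sub>F s in at_right 0. p + s *\<^sub>R u \<in> P \<and> s > 0"
        using eventually_at_right_less by eventually_elim simp
      then obtain s where s: "p + s *\<^sub>R u \<in> P" "s > 0"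
        using eventually_happens trivial_limit_at_right_real by blast
      have "(x - p) \<bullet> ((p + s *\<^sub>R u) - p) \<le> 0"
        unfolding p_def by (rule closest_point_dot[OF \<open>convex P\<close> \<open>closed P\<close> s(1)[unfolded p_def]])
      then show ?thesis using s(2) by (simp add: mult_le_0_iff)
    qed
    moreover have "\<forall>a\<in>fst ` I. a \<bullet> (x - p) \<le> r"
      using r(2) by (force simp: I_def inner_diff_right)
    moreover have "I \<in> Pow H" by (auto simp: I_def)
    ultimately have "\<epsilon> I * norm (x - p) \<le> r"
      using r(1) \<epsilon> by simp
    moreover have "m * norm (x - p) \<le> \<epsilon> I * norm (x - p)"
      by (intro mult_right_mono m) (auto simp: I_def)
    ultimately have "dist x p \<le> (1 / m) * r"
      using m(1) by (simp add: dist_norm field_simps)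
    with p show ?thesis by blast
  qed
  then show ?thesis using m(1) unfolding P_def by (intro exI[of _ "1 / m"]) auto
qed

text \<open>
  The form used below: inside \<open>Q\<close> only the equation \<open>A x = q\<close> is violated. It is written as
  inequalities with the vectors \<open>\<plusminus>e\<close> of an orthonormal basis.
\<close>

lemma hoffman_bound_polyhedron:
  fixes A :: "'a::euclidean_space \<Rightarrow> 'b::euclidean_space"
  assumes A: "linear A" and Q: "polyhedron Q" and ne: "x0 \<in> Q" "A x0 = q"
  shows "\<exists>\<kappa>\<ge>0. \<forall>x\<in>Q. \<exists>p\<in>Q. A p = q \<and> dist x p \<le> \<kappa> * norm (A x - q)"
proof -
  obtain H where H: "finite H" "Q = linear_solutions H"
    using polyhedron_linear_solutions[OF Q] .
  define E where "E = (\<lambda>e. (adjoint A e, e \<bullet> q)) ` (Basis \<union> uminus ` Basis)"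
  have adj: "adjoint A e \<bullet> x = e \<bullet> A x" for e x
    by (simp add: adjoint_clauses[OF A])
  have "(\<forall>(a, b)\<in>E. a \<bullet> x \<le> b) \<longleftrightarrow> (\<forall>e\<in>Basis. e \<bullet> A x \<le> e \<bullet> q \<and> e \<bullet> q \<le> e \<bullet> A x)" for x
    by (simp add: E_def adj ball_Un) blast
  moreover have "A x = q \<longleftrightarrow> (\<forall>e\<in>Basis. e \<bullet> A x \<le> e \<bullet> q \<and> e \<bullet> q \<le> e \<bullet> A x)" for x
    by (auto simp: euclidean_eq_iff[where 'a='b] inner_commute intro: order_antisym)
  ultimately have E: "(\<forall>(a, b)\<in>E. a \<bullet> x \<le> b) \<longleftrightarrow> A x = q" for x
    by simp
  have sol: "linear_solutions (H \<union> E) = {x\<in>Q. A x = q}"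
    using E by (auto simp: linear_solutions_def H(2) ball_Un)
  have "finite (H \<union> E)" using H(1) by (simp add: E_def)
  moreover have "linear_solutions (H \<union> E) \<noteq> {}" using ne sol by auto
  ultimately obtain \<kappa> where \<kappa>: "\<kappa> \<ge> 0" "\<And>x r. 0 \<le> r \<Longrightarrow> (\<forall>(a, b)\<in>H \<union> E. a \<bullet> x \<le> b + r) \<Longrightarrow>
           (\<exists>p\<in>linear_solutions (H \<union> E). dist x p \<le> \<kappa> * r)"
    using hoffman_bound_inequalities by blast
  have "\<exists>p\<in>Q. A p = q \<and> dist x p \<le> \<kappa> * norm (A x - q)" if x: "x \<in> Q" for x
  proof -
    have "e \<bullet> A x \<le> e \<bullet> q + norm (A x - q)" if "e \<in> Basis \<union> uminus ` Basis" for e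
    proof -
      have "e \<bullet> (A x - q) \<le> norm e * norm (A x - q)" by (rule norm_cauchy_schwarz)
      moreover have "norm e = 1" using that by auto
      ultimately show ?thesis by (simp add: inner_diff_right)
    qed
    then have "\<forall>(a, b)\<in>E. a \<bullet> x \<le> b + norm (A x - q)"
      by (auto simp: E_def adj)
    moreover have "\<forall>(a, b)\<in>H. a \<bullet> x \<le> b + norm (A x - q)"
      using x by (force simp: H(2) linear_solutions_def intro: add_increasing2)
    ultimately have "\<forall>(a, b)\<in>H \<union> E. a \<bullet> x \<le> b + norm (A x - q)" by blast
    from \<kappa>(2)[OF norm_ge_zero this] show ?thesis unfolding sol by auto
  qed
  with \<kappa>(1) show ?thesis by blast
qed

text \<open>
  A tangent direction of a general closed convex set need not be feasible (a disc at a boundary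
  point); for a polyhedron it is, as the tangent inequalities of the active constraints suffice.
\<close>

lemma polyhedron_tangent_direction_feasible:
  fixes Z :: "'a::euclidean_space set"
  assumes Z: "polyhedron Z" "z \<in> Z" and d: "d \<in> tangent_cone Z z"
  shows "\<forall>\<^sub>F t in at_right 0. z + t *\<^sub>R d \<in> Z"
proof -
  obtain H where H: "finite H" "Z = linear_solutions H"
    using polyhedron_linear_solutions[OF Z(1)] .
  obtain s e where s: "\<And>k. s k > 0" "e \<longlonglongrightarrow> d" "\<And>k::nat. z + s k *\<^sub>R e k \<in> Z"
    using d by (auto simp: tangent_cone_def)
  have "a \<bullet> d \<le> 0" if ab: "(a, b) \<in> H" "a \<bullet> z = b" for a b
  proof -
    have "a \<bullet> e k \<le> 0" for k
    proof -
      have "a \<bullet> (z + s k *\<^sub>R e k) \<le> b"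
        using s(3)[of k] ab(1) by (auto simp: H(2) linear_solutions_def)
      then show ?thesis
        using ab(2) s(1)[of k] by (simp add: inner_add_right mult_le_0_iff)
    qed
    moreover have "(\<lambda>k. a \<bullet> e k) \<longlonglongrightarrow> a \<bullet> d"
      using s(2) by (intro tendsto_intros)
    ultimately show ?thesis by (intro LIMSEQ_le_const2) auto
  qed
  then show ?thesis
    using Z(2) unfolding H(2) by (intro eventually_feasible_direction H(1)) auto
qed

section \<open>Normal cones and exposed faces of a polyhedron\<close>

text \<open>
  The graph of this map, \<open>x \<in> P\<close> and \<open>z\<close> in the normal cone of \<open>P\<close> at \<open>x\<close>, carries both cases of
  the theorem: the map itself is the subdifferential of the support function of \<open>P\<close>, its inverse
  that of the indicator function.
\<close>

definition maximizers :: "'a::real_inner set \<Rightarrow> 'a \<Rightarrow> 'a set" where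
  "maximizers P z = {x\<in>P. \<forall>u\<in>P. z \<bullet> u \<le> z \<bullet> x}"

text \<open>
  The trace of polyhedrality on a subdifferential that the main argument relies on: a piecewise
  linear convex function has no subgradients near a point that are not already subgradients at
  that point, as \<open>\<lambda>t. \<bar>t\<bar>\<close> shows at \<open>0\<close>; strict curvature destroys this.
\<close>

definition outer_stable :: "('a::euclidean_space \<Rightarrow> 'a set) \<Rightarrow> bool" where
  "outer_stable S \<longleftrightarrow> (\<forall>z. polyhedron (S z)) \<and> (\<forall>z. \<forall>\<^sub>F w in nhds z. S w \<subseteq> S z)"

lemma set_inverse_set_inverse [simp]: "set_inverse (set_inverse F) = F"
  by (simp add: set_inverse_def fun_eq_iff)

lemma maximizers_eq_face:
  assumes "x \<in> maximizers P z"
  shows "maximizers P z = P \<inter> {u. z \<bullet> u = z \<bullet> x}"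
  using assms by (fastforce simp: maximizers_def)

lemma maximizers_face_of:
  assumes "convex P"
  shows "maximizers P z face_of P"
proof (cases "maximizers P z = {}")
  case False
  then obtain x where x: "x \<in> maximizers P z" by blast
  have "P \<inter> {u. z \<bullet> u = z \<bullet> x} face_of P"
    using assms x by (intro face_of_Int_supporting_hyperplane_le) (auto simp: maximizers_def)
  then show ?thesis using maximizers_eq_face[OF x] by simp
qed simp

text \<open>
  Each value is a face of \<open>P\<close>, and there are only finitely many faces. A face that is not contained
  in \<open>maximizers P z\<close> has a point that is not maximal for \<open>z\<close>, hence not maximal for nearby
  functionals, so near \<open>z\<close> the face does not occur as a value.
\<close>

lemma outer_stable_maximizers:
  fixes P :: "'a::euclidean_space set"
  assumes P: "polyhedron P"
  shows "outer_stable (maximizers P)"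
proof -
  have cP: "convex P" by (rule polyhedron_imp_convex[OF P])
  define G where "G z = {F. F face_of P \<and> \<not> F \<subseteq> maximizers P z}" for z
  have "\<forall>\<^sub>F w in nhds z. maximizers P w \<subseteq> maximizers P z" for z
  proof -
    have "\<forall>F\<in>G z. \<exists>x. x \<in> F \<and> x \<notin> maximizers P z" by (auto simp: G_def)
    then obtain x where x: "\<And>F. F \<in> G z \<Longrightarrow> x F \<in> F \<and> x F \<notin> maximizers P z"
      by metis
    have fin: "finite (G z)"
      using finite_polyhedron_faces[OF P] by (rule rev_finite_subset) (auto simp: G_def)
    have "\<forall>F\<in>G z. \<forall>\<^sub>F w in nhds z. x F \<notin> maximizers P w"
    proof
      fix F assume F: "F \<in> G z"
      then have "x F \<in> P" using x[OF F] face_of_imp_subset by (auto simp: G_def)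
      then obtain u where u: "u \<in> P" "z \<bullet> x F < z \<bullet> u"
        using x[OF F] by (force simp: maximizers_def)
      have "((\<lambda>w. w \<bullet> u - w \<bullet> x F) \<longlongrightarrow> z \<bullet> u - z \<bullet> x F) (nhds z)"
        by (intro tendsto_intros filterlim_ident)
      then have "\<forall>\<^sub>F w in nhds z. 0 < w \<bullet> u - w \<bullet> x F"
        using u(2) by (intro order_tendstoD(1)[where a=0]) auto
      then show "\<forall>\<^sub>F w in nhds z. x F \<notin> maximizers P w"
        by eventually_elim (use u(1) in \<open>force simp: maximizers_def\<close>)
    qed
    then have "\<forall>\<^sub>F w in nhds z. \<forall>F\<in>G z. x F \<notin> maximizers P w"
      using fin by (simp add: eventually_ball_finite)
    then show ?thesis
    proof eventually_elim
      case (elim w)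
      show ?case
      proof (rule ccontr)
        assume "\<not> maximizers P w \<subseteq> maximizers P z"
        then have "maximizers P w \<in> G z"
          using maximizers_face_of[OF cP] by (simp add: G_def)
        then show False using elim x by blast
      qed
    qed
  qed
  moreover have "polyhedron (maximizers P z)" for z
    using face_of_polyhedron_polyhedron[OF P maximizers_face_of[OF cP]] .
  ultimately show ?thesis by (simp add: outer_stable_def)
qed

text \<open>
  Intersecting \<open>P\<close> with a box around \<open>x\<close> gives a polytope. Maximality of \<open>x\<close> is a local property by
  convexity, so it can be tested on the finitely many vertices of that polytope, each of which
  contributes one linear inequality on the normal vectors.
\<close>

lemma polyhedron_normal_cone:
  fixes P :: "'a::euclidean_space set"
  assumes P: "polyhedron P"
  shows "polyhedron (set_inverse (maximizers P) x)"
proof (cases "x \<in> P")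
  case False
  then have "set_inverse (maximizers P) x = {}"
    by (auto simp: set_inverse_def maximizers_def)
  then show ?thesis by simp
next
  case True
  define B where "B = cbox (x - One) (x + One)"
  have "polytope (P \<inter> B)"
    unfolding B_def by (subst Int_commute, rule polytope_Int_polyhedron[OF polytope_interval P])
  then obtain V where V: "finite V" "P \<inter> B = convex hull V"
    by (auto simp: polytope_def)
  have xB: "x \<in> interior B"
    by (simp add: B_def interior_cbox mem_box inner_diff_left inner_add_left)
  have "set_inverse (maximizers P) x = \<Inter>((\<lambda>w. {z. (w - x) \<bullet> z \<le> 0}) ` V)"
  proof (intro equalityI subsetI)
    fix z assume "z \<in> set_inverse (maximizers P) x"
    moreover have "V \<subseteq> P" using hull_subset[of V convex] V(2) by blast
    ultimately show "z \<in> \<Inter>((\<lambda>w. {z. (w - x) \<bullet> z \<le> 0}) ` V)"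
      by (auto simp: set_inverse_def maximizers_def inner_diff_left inner_diff_right inner_commute)
  next
    fix z assume z: "z \<in> \<Inter>((\<lambda>w. {z. (w - x) \<bullet> z \<le> 0}) ` V)"
    have "V \<subseteq> {w. z \<bullet> w \<le> z \<bullet> x}"
      using z by (auto simp: inner_diff_left inner_diff_right inner_commute)
    then have "convex hull V \<subseteq> {w. z \<bullet> w \<le> z \<bullet> x}"
      by (intro hull_minimal convex_halfspace_le)
    then have loc: "z \<bullet> w \<le> z \<bullet> x" if "w \<in> P" "w \<in> B" for w
      using that V(2) by blast
    have "z \<bullet> u \<le> z \<bullet> x" if u: "u \<in> P" for u
    proof -
      have "((\<lambda>s. x + s *\<^sub>R (u - x)) \<longlongrightarrow> x + 0 *\<^sub>R (u - x)) (at_right 0)"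
        by (intro tendsto_intros)
      then have "\<forall>\<^sub>F s in at_right 0. x + s *\<^sub>R (u - x) \<in> interior B"
        using xB by (auto dest: topological_tendstoD[where S="interior B"])
      moreover have "\<forall>\<^sub>F s in at_right (0::real). s \<in> {0<..<1}"
        by (rule eventually_at_right_real) simp
      ultimately have "\<forall>\<^sub>F s in at_right 0. x + s *\<^sub>R (u - x) \<in> interior B \<and> s \<in> {0<..<1}"
        by eventually_elim simp
      then obtain s where s: "x + s *\<^sub>R (u - x) \<in> interior B" "0 < s" "s < 1"
        using eventually_happens trivial_limit_at_right_real by fastforce
      have "(1 - s) *\<^sub>R x + s *\<^sub>R u \<in> P"
        using polyhedron_imp_convex[OF P] True u s by (intro convexD) auto
      then have "x + s *\<^sub>R (u - x) \<in> P" by (simp add: algebra_simps)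
      then have "z \<bullet> (x + s *\<^sub>R (u - x)) \<le> z \<bullet> x"
        using s(1) interior_subset by (intro loc) auto
      then have "s * (z \<bullet> (u - x)) \<le> 0" by (simp add: inner_add_right)
      then show ?thesis using s(2) by (simp add: mult_le_0_iff inner_diff_right)
    qed
    then show "z \<in> set_inverse (maximizers P) x"
      using True by (simp add: set_inverse_def maximizers_def)
  qed
  then show ?thesis
    using V(1) by (auto intro!: polyhedron_Inter polyhedron_halfspace_le)
qed

text \<open>
  Here the values being compared are normal cones at different points. A vector \<open>z\<close> is normal at \<open>w\<close>
  iff \<open>w\<close> lies in the face \<open>maximizers P z\<close>. Points near \<open>x\<close> avoid all the (finitely many, closed)
  faces that miss \<open>x\<close>, so every face through such a \<open>w\<close> also passes through \<open>x\<close>.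
\<close>

lemma outer_stable_normal_cone:
  fixes P :: "'a::euclidean_space set"
  assumes P: "polyhedron P"
  shows "outer_stable (set_inverse (maximizers P))"
proof -
  have cP: "convex P" by (rule polyhedron_imp_convex[OF P])
  have "\<forall>\<^sub>F w in nhds x. set_inverse (maximizers P) w \<subseteq> set_inverse (maximizers P) x" for x
  proof -
    define U where "U = - \<Union>{F. F face_of P \<and> x \<notin> F}"
    have "closed (\<Union>{F. F face_of P \<and> x \<notin> F})"
      using finite_polyhedron_faces[OF P]
      by (intro closed_Union) (auto intro: polyhedron_imp_closed face_of_polyhedron_polyhedron[OF P])
    then have "open U" "x \<in> U" by (auto simp: U_def)
    then have "\<forall>\<^sub>F w in nhds x. w \<in> U" by (auto simp: eventually_nhds)
    then show ?thesis
      by eventually_elim (use maximizers_face_of[OF cP] in \<open>auto simp: set_inverse_def U_def\<close>)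
  qed
  then show ?thesis
    using polyhedron_normal_cone[OF P] by (simp add: outer_stable_def)
qed

section \<open>Indicator and support functions\<close>

lemma subdifferential_indicator_fn:
  fixes P :: "'a::euclidean_space set"
  assumes "P \<noteq> {}"
  shows "subdifferential (indicator_fn P) = set_inverse (maximizers P)"
proof -
  have "v \<in> subdifferential (indicator_fn P) z \<longleftrightarrow> z \<in> maximizers P v" for v z
  proof (cases "z \<in> P")
    case True
    have "(indicator_fn P z + ereal (v \<bullet> (w - z)) \<le> indicator_fn P w) \<longleftrightarrow> (w \<in> P \<longrightarrow> v \<bullet> w \<le> v \<bullet> z)"
      for w using True by (simp add: indicator_fn_def inner_diff_right)
    then show ?thesis using True by (auto simp: subdifferential_def maximizers_def)
  next
    case False
    obtain u where "u \<in> P" using assms by blast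
    then show ?thesis using False
      by (auto simp: subdifferential_def maximizers_def indicator_fn_def intro!: exI[of _ u])
  qed
  then show ?thesis by (auto simp: set_inverse_def fun_eq_iff)
qed

lemma subdifferential_support_fn:
  fixes P :: "'a::euclidean_space set"
  assumes P: "closed P" "convex P" "P \<noteq> {}"
  shows "subdifferential (support_fn P) = maximizers P"
proof -
  have up: "ereal (z \<bullet> u) \<le> support_fn P z" if "u \<in> P" for u z
    using that by (auto simp: support_fn_def intro: SUP_upper)
  have sp: "support_fn P z \<noteq> -\<infinity>" for z using up[of _ z] P(3) by fastforce
  have s0: "support_fn P 0 = 0" using P(3) by (simp add: support_fn_def zero_ereal_def[symmetric])
  have "v \<in> subdifferential (support_fn P) z \<longleftrightarrow> v \<in> maximizers P z" for v z
  proof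
    assume "v \<in> maximizers P z"
    then have v: "v \<in> P" "support_fn P z = ereal (z \<bullet> v)"
      using up[of v z] by (auto simp: maximizers_def support_fn_def intro!: antisym SUP_least)
    then show "v \<in> subdifferential (support_fn P) z"
      using up[OF v(1)] by (auto simp: subdifferential_def inner_diff_right inner_commute)
  next
    assume "v \<in> subdifferential (support_fn P) z"
    then have v: "support_fn P z + ereal (v \<bullet> (w - z)) \<le> support_fn P w" for w
      by (simp add: subdifferential_def)
    obtain r where r: "support_fn P z = ereal r" and r0: "r \<le> v \<bullet> z"
      using v[of 0] s0 sp[of z] by (cases "support_fn P z") auto
    \<comment> \<open>With \<open>w = z + u\<close> in the subgradient inequality, subadditivity bounds \<open>v \<bullet> u\<close> by the support
      function at \<open>u\<close>, which forces \<open>v \<in> P\<close> by separation.\<close>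
    have sup2: "support_fn P (w + z) \<le> support_fn P w + support_fn P z" for w
      unfolding support_fn_def using sp[of w] sp[of z]
      by (intro SUP_least) (auto simp: inner_add_left support_fn_def plus_ereal.simps(1)[symmetric] simp del: plus_ereal.simps intro!: add_mono SUP_upper)
    have le: "ereal (v \<bullet> w) \<le> support_fn P w" for w
      using v[of "w + z"] sup2[of w] r sp[of w] sp[of "w + z"]
      by (cases "support_fn P w"; cases "support_fn P (w + z)") auto
    have "v \<in> P"
    proof (rule ccontr)
      assume "v \<notin> P"
      then obtain a b where ab: "a \<bullet> v < b" "\<And>x. x \<in> P \<Longrightarrow> b < a \<bullet> x"
        using separating_hyperplane_closed_point[OF P(2,1)] by blast
      have "support_fn P (- a) \<le> ereal (- b)"
        unfolding support_fn_def using ab(2) by (intro SUP_least) (auto simp: less_imp_le)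
      with le[of "- a"] have "ereal (v \<bullet> (- a)) \<le> ereal (- b)" by (rule order_trans)
      then show False using ab(1) by (simp add: inner_commute)
    qed
    moreover have "z \<bullet> u \<le> z \<bullet> v" if "u \<in> P" for u
      using up[OF that, of z] r r0 by (simp add: inner_commute)
    ultimately show "v \<in> maximizers P z" by (simp add: maximizers_def)
  qed
  then show ?thesis by (auto simp: fun_eq_iff)
qed

lemma eproper_indicator_fn: "P \<noteq> {} \<Longrightarrow> eproper (indicator_fn P)"
  by (auto simp: eproper_def edom_def indicator_fn_def)

lemma eproper_support_fn:
  assumes "P \<noteq> {}"
  shows "eproper (support_fn P)"
proof -
  obtain u where u: "u \<in> P" using assms by blast
  have "ereal (z \<bullet> u) \<le> support_fn P z" for z
    unfolding support_fn_def using u by (rule SUP_upper)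
  then have "support_fn P z \<noteq> -\<infinity>" for z
    by (metis MInfty_neq_ereal(1) ereal_infty_less_eq(2))
  moreover have "support_fn P 0 = 0"
    using assms by (simp add: support_fn_def zero_ereal_def[symmetric])
  then have "0 \<in> edom (support_fn P)" by (simp add: edom_def)
  ultimately show ?thesis by (auto simp: eproper_def)
qed

section \<open>The primal-dual error bound\<close>

text \<open>
  For a Lipschitz map, directional derivatives may be computed along varying directions: replacing
  \<open>d\<close> by \<open>w n\<close> changes the quotient by at most \<open>L * norm (w n - d)\<close>.
\<close>

lemma tendsto_quotient_of_lipschitz:
  fixes F :: "'a::real_normed_vector \<Rightarrow> 'b::real_normed_vector"
  assumes lip: "L-lipschitz_on (ball y e) F" and e: "e > 0"
    and D: "has_dir_deriv F y d D"
    and t: "\<And>n. t n > 0" "t \<longlonglongrightarrow> 0" and w: "w \<longlonglongrightarrow> d"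
  shows "(\<lambda>n. (F (y + t n *\<^sub>R w n) - F y) /\<^sub>R t n) \<longlonglongrightarrow> D"
proof -
  have "filterlim t (at_right 0) sequentially"
    using t by (intro tendsto_imp_filterlim_at_right) auto
  then have lim: "(\<lambda>n. (F (y + t n *\<^sub>R d) - F y) /\<^sub>R t n) \<longlonglongrightarrow> D"
    using D unfolding has_dir_deriv_def by (rule filterlim_compose[rotated])
  have inball: "\<forall>\<^sub>F n in sequentially. y + t n *\<^sub>R u n \<in> ball y e" if "u \<longlonglongrightarrow> d" for u
  proof -
    have "(\<lambda>n. y + t n *\<^sub>R u n) \<longlonglongrightarrow> y + 0 *\<^sub>R d"
      using t that by (intro tendsto_intros)
    then show ?thesis using e by (auto dest: topological_tendstoD[where S="ball y e"])
  qed
  have "\<forall>\<^sub>F n in sequentially.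
      norm ((F (y + t n *\<^sub>R w n) - F (y + t n *\<^sub>R d)) /\<^sub>R t n) \<le> L * norm (w n - d)"
    using inball[OF w] inball[OF tendsto_const]
  proof eventually_elim
    case (elim n)
    define X where "X = F (y + t n *\<^sub>R w n) - F (y + t n *\<^sub>R d)"
    have "norm X \<le> L * norm (t n *\<^sub>R (w n - d))"
      using lipschitz_onD[OF lip elim] by (simp add: X_def dist_norm scaleR_diff_right)
    also have "\<dots> = (L * norm (w n - d)) * t n" using t(1)[of n] by simp
    finally have "norm X / t n \<le> L * norm (w n - d)"
      using t(1)[of n] by (simp add: pos_divide_le_eq)
    moreover have "norm (X /\<^sub>R t n) = norm X / t n"
      using t(1)[of n] by (simp add: field_simps)
    ultimately show ?case unfolding X_def[symmetric] by simp
  qed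
  moreover have "(\<lambda>n. L * norm (w n - d)) \<longlonglongrightarrow> 0"
    using tendsto_mult_right_zero[OF tendsto_norm_zero[OF LIM_zero[OF w]]] .
  ultimately have "(\<lambda>n. (F (y + t n *\<^sub>R w n) - F (y + t n *\<^sub>R d)) /\<^sub>R t n) \<longlonglongrightarrow> 0"
    by (rule Lim_null_comparison)
  from tendsto_add[OF this lim] show ?thesis
    by (simp add: scaleR_add_right[symmetric] del: scaleR_add_right)
qed

text \<open>
  The abstract situation: \<open>F\<close> stands for the gradient of the smooth part, \<open>S\<close> for the
  subdifferential of the polyhedral part, and the solution at hand is \<open>(y0, z0, x0)\<close>. The second
  order condition is required along those \<open>d\<close> for which \<open>x0\<close> stays a subgradient on a short segment
  from \<open>z0\<close> in direction \<open>- adjoint A d\<close>; by polyhedrality this is what membership in the critical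
  cone provides.
\<close>

locale second_order_kkt =
  fixes A :: "'x::euclidean_space \<Rightarrow> 'y::euclidean_space"
    and F :: "'y \<Rightarrow> 'y" and S :: "'x \<Rightarrow> 'x set"
    and y0 :: 'y and z0 x0 :: 'x and L \<epsilon> :: real
  assumes A: "linear A"
    and lip: "L-lipschitz_on (ball y0 \<epsilon>) F" and \<epsilon>: "\<epsilon> > 0"
    and dirdiff: "\<exists>D. has_dir_deriv F y0 d D"
    and stable: "outer_stable S" and stable_inv: "outer_stable (set_inverse S)"
    and mono: "x \<in> S z \<Longrightarrow> x' \<in> S z' \<Longrightarrow> 0 \<le> (x - x') \<bullet> (z - z')"
    and x0: "x0 \<in> S z0" and F0: "F y0 = A x0"
    and second_order: "d \<noteq> 0 \<Longrightarrow> \<forall>\<^sub>F t in at_right 0. x0 \<in> S (z0 - t *\<^sub>R adjoint A d) \<Longrightarrow>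
      has_dir_deriv F y0 d D \<Longrightarrow> 0 < d \<bullet> D"
begin

text \<open>
  The multipliers for \<open>(y0, z0)\<close> are the solutions of \<open>A p = F y0\<close> in the polyhedron \<open>S z0\<close>. A perturbed
  multiplier \<open>x + b \<in> S z\<close> lies in \<open>S z0\<close> by stability, so Hoffman's bound controls its distance to
  this set by \<open>F y - F y0\<close> and the perturbations.
\<close>

lemma multiplier_bound:
  "\<exists>\<kappa>\<ge>0. \<forall>\<^sub>F z in nhds z0. \<forall>y x a b. y \<in> ball y0 \<epsilon> \<longrightarrow> F y = A x + a \<longrightarrow> x + b \<in> S z \<longrightarrow>
     (\<exists>p\<in>S z0. A p = F y0 \<and> norm (x - p) \<le> \<kappa> * (norm (y - y0) + norm a + norm b))"
proof -
  interpret A: bounded_linear A using A by (simp add: linear_conv_bounded_linear)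
  have L: "L \<ge> 0" using lip by (rule lipschitz_on_nonneg)
  obtain K where K: "K > 0" "\<And>v. norm (A v) \<le> norm v * K"
    using A.pos_bounded by blast
  have "polyhedron (S z0)" using stable by (simp add: outer_stable_def)
  from hoffman_bound_polyhedron[OF A this x0, of "F y0"]
  obtain M where M: "M \<ge> 0"
    "\<And>x. x \<in> S z0 \<Longrightarrow> \<exists>p\<in>S z0. A p = F y0 \<and> dist x p \<le> M * norm (A x - F y0)"
    using F0 by auto
  define \<kappa> where "\<kappa> = M * (L + 1 + K) + 1"
  have "\<kappa> \<ge> 0" using M(1) L K(1) by (simp add: \<kappa>_def)
  moreover have "\<exists>p\<in>S z0. A p = F y0 \<and> norm (x - p) \<le> \<kappa> * (norm (y - y0) + norm a + norm b)"
    if y: "y \<in> ball y0 \<epsilon>" and F: "F y = A x + a" and b: "x + b \<in> S z0" for y x a b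
  proof -
    obtain p where p: "p \<in> S z0" "A p = F y0" "dist (x + b) p \<le> M * norm (A (x + b) - F y0)"
      using M(2)[OF b] by blast
    define s where "s = norm (y - y0) + norm a + norm b"
    have "A (x + b) - F y0 = (F y - F y0) - a + A b"
      using F by (simp add: A.add)
    also have "norm \<dots> \<le> norm (F y - F y0) + norm a + norm (A b)"
      using norm_triangle_ineq[of "F y - F y0 - a" "A b"] norm_triangle_ineq4[of "F y - F y0" a]
      by linarith
    also have "norm (F y - F y0) \<le> L * norm (y - y0)"
      using lipschitz_onD[OF lip y, of y0] \<epsilon> by (simp add: dist_norm)
    also have "norm (A b) \<le> norm b * K" by (rule K)
    also have "L * norm (y - y0) + norm a + norm b * K \<le> L * s + 1 * s + s * K"
      unfolding s_def using L K(1)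
      by (intro add_mono mult_mono) auto
    finally have "norm (A (x + b) - F y0) \<le> (L + 1 + K) * s"
      by (simp add: algebra_simps)
    then have "M * norm (A (x + b) - F y0) \<le> M * ((L + 1 + K) * s)"
      using M(1) by (rule mult_left_mono)
    then have "norm (x + b - p) \<le> M * ((L + 1 + K) * s)"
      using p(3) by (simp add: dist_norm)
    moreover have "norm (x - p) \<le> norm (x + b - p) + norm b"
      using norm_triangle_ineq4[of "x + b - p" b] by (simp add: algebra_simps)
    moreover have "norm b \<le> s" by (simp add: s_def)
    ultimately have "norm (x - p) \<le> \<kappa> * s" by (simp add: \<kappa>_def algebra_simps)
    with p show ?thesis unfolding s_def by blast
  qed
  moreover have "\<forall>\<^sub>F z in nhds z0. S z \<subseteq> S z0"
    using stable by (simp add: outer_stable_def)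
  ultimately show ?thesis
    by (intro exI[of _ \<kappa>] conjI) (auto elim!: eventually_mono)
qed

text \<open>
  Monotonicity of \<open>S\<close>, applied with an arbitrary multiplier \<open>p\<close>. The freedom in \<open>p\<close> matters: with
  \<open>p = x0\<close> the factor \<open>norm (x - p)\<close> merely tends to \<open>0\<close>, while by the multiplier bound a suitable
  \<open>p\<close> makes it of the order of \<open>norm (y - y0) + norm a + norm b\<close>.
\<close>

lemma monotonicity_gap:
  assumes F: "F y = A x + a" and xb: "x + b \<in> S z" and p: "p \<in> S z0" "A p = F y0"
    and e: "e = adjoint A (y - y0) + (z - z0)"
  shows "(F y - F y0) \<bullet> (y - y0) \<le>
    norm (x - p) * norm e + norm b * norm (z - z0) + norm a * norm (y - y0)"
proof -
  have "F y - F y0 = A (x - p) + a"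
    using F p(2) by (simp add: linear_diff[OF A])
  then have "(F y - F y0) \<bullet> (y - y0) = (x - p) \<bullet> (e - (z - z0)) + a \<bullet> (y - y0)"
    by (simp add: inner_add_left adjoint_works[OF A] e)
  also have "\<dots> = (x - p) \<bullet> e + b \<bullet> (z - z0) - (x + b - p) \<bullet> (z - z0) + a \<bullet> (y - y0)"
    by (simp add: algebra_simps)
  also have "\<dots> \<le> (x - p) \<bullet> e + b \<bullet> (z - z0) + a \<bullet> (y - y0)"
    using mono[OF xb p(1)] by simp
  also have "\<dots> \<le> norm (x - p) * norm e + norm b * norm (z - z0) + norm a * norm (y - y0)"
    by (intro add_mono norm_cauchy_schwarz)
  finally show ?thesis .
qed

text \<open>
  The size of the perturbation of the three optimality conditions; the last summand is the
  residual of the linear constraint, in which the right-hand side \<open>c\<close> has been eliminated by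
  feasibility of \<open>(y0, z0)\<close>.
\<close>

definition residual :: "'y \<Rightarrow> 'x \<Rightarrow> 'y \<Rightarrow> 'x \<Rightarrow> real" where
  "residual a b y z = norm a + norm b + norm (adjoint A (y - y0) + (z - z0))"

lemma residual_nonneg: "0 \<le> residual a b y z"
  by (simp add: residual_def)

text \<open>
  The core of the argument. Suppose the residuals \<open>\<rho> n\<close> were negligible against \<open>t n = norm (y n - y0)\<close>.
  The limit \<open>d\<close> of the normalised displacements of \<open>y\<close> is a unit vector, those of \<open>z\<close> converge to
  \<open>- adjoint A d\<close>, and outer stability of the inverse of \<open>S\<close> shows that this direction keeps \<open>x0\<close> a
  subgradient. The second order condition gives \<open>0 < d \<bullet> D\<close>, whereas dividing the gap inequality
  by \<open>(t n)\<^sup>2\<close> and letting \<open>n\<close> tend to infinity gives \<open>d \<bullet> D \<le> 0\<close>.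
\<close>

lemma no_sublinear_sequence:
  assumes y: "y \<longlonglongrightarrow> y0" and z: "z \<longlonglongrightarrow> z0" and x: "x \<longlonglongrightarrow> x0"
    and F: "\<And>n. F (y n) = A (x n) + a n" and b: "\<And>n. x n + b n \<in> S (z n)"
    and r: "\<And>n. real (Suc n) * residual (a n) (b n) (y n) (z n) < norm (y n - y0)"
    and d: "(\<lambda>n. (y n - y0) /\<^sub>R norm (y n - y0)) \<longlonglongrightarrow> d"
  shows False
proof -
  define t where "t n = norm (y n - y0)" for n
  define w where "w n = (y n - y0) /\<^sub>R t n" for n
  define e where "e n = adjoint A (y n - y0) + (z n - z0)" for n
  define \<rho> where "\<rho> n = residual (a n) (b n) (y n) (z n)" for n
  interpret B: bounded_linear "adjoint A"
    using adjoint_linear[OF A] by (simp add: linear_conv_bounded_linear)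
  have \<rho>0: "\<rho> n \<ge> 0" for n by (simp add: \<rho>_def residual_def)
  have t: "t n > 0" for n
  proof -
    have "0 \<le> real (Suc n) * \<rho> n" using \<rho>0[of n] by simp
    then show ?thesis using r[of n] unfolding t_def \<rho>_def by (rule le_less_trans)
  qed
  have t0: "t \<longlonglongrightarrow> 0"
    unfolding t_def using tendsto_norm_zero[OF LIM_zero[OF y]] .
  have w: "w \<longlonglongrightarrow> d" using d by (simp add: w_def[abs_def] t_def[abs_def])
  have "norm (w n) = 1" for n using t[of n] by (simp add: w_def t_def)
  then have "norm d = 1" using tendsto_norm[OF w] by (simp add: LIMSEQ_const_iff)
  have quot: "\<rho> n / t n \<le> inverse (real (Suc n))" for n
    using r[of n] t[of n] by (simp add: \<rho>_def t_def field_simps)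
  have quot0: "(\<lambda>n. \<rho> n / t n) \<longlonglongrightarrow> 0"
    by (rule tendsto_sandwich[OF _ _ tendsto_const LIMSEQ_inverse_real_of_nat])
      (use quot \<rho>0 t in \<open>auto intro!: always_eventually divide_nonneg_pos\<close>)
  have \<rho>t: "\<rho> n \<le> t n" for n
  proof -
    have "\<rho> n \<le> real (Suc n) * \<rho> n" using \<rho>0[of n] by (simp add: algebra_simps)
    then show ?thesis using r[of n] by (simp add: \<rho>_def t_def)
  qed
  have bounds: "norm (a n) \<le> \<rho> n" "norm (b n) \<le> \<rho> n" "norm (e n) \<le> \<rho> n"
    "norm (a n) + norm (b n) \<le> \<rho> n" for n
    by (auto simp: \<rho>_def residual_def e_def)
  have b0: "b \<longlonglongrightarrow> 0"
    by (rule Lim_null_comparison[OF _ t0])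
      (use order_trans[OF bounds(2) \<rho>t] in \<open>auto intro!: always_eventually\<close>)
  have "norm (e n /\<^sub>R t n) \<le> \<rho> n / t n" for n
  proof -
    have "norm (e n /\<^sub>R t n) = norm (e n) / t n"
      using t[of n] by (simp add: divide_inverse mult.commute)
    then show ?thesis
      using divide_right_mono[OF bounds(3)[of n], of "t n"] t[of n] by simp
  qed
  then have "(\<lambda>n. e n /\<^sub>R t n) \<longlonglongrightarrow> 0"
    by (intro Lim_null_comparison[OF always_eventually quot0]) blast
  moreover have "(\<lambda>n. adjoint A (w n)) \<longlonglongrightarrow> adjoint A d"
    using B.tendsto[OF w] .
  ultimately have "(\<lambda>n. e n /\<^sub>R t n - adjoint A (w n)) \<longlonglongrightarrow> 0 - adjoint A d"
    by (rule tendsto_diff)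
  moreover have "e n /\<^sub>R t n - adjoint A (w n) = (z n - z0) /\<^sub>R t n" for n
    by (simp add: e_def w_def B.scaleR scaleR_add_right)
  ultimately have zd: "(\<lambda>n. (z n - z0) /\<^sub>R t n) \<longlonglongrightarrow> - adjoint A d"
    by simp
  have feasible: "\<forall>\<^sub>F s in at_right 0. x0 \<in> S (z0 - s *\<^sub>R adjoint A d)"
  proof -
    have "\<forall>\<^sub>F v in nhds x0. set_inverse S v \<subseteq> set_inverse S x0"
      using stable_inv by (simp add: outer_stable_def)
    moreover have "(\<lambda>n. x n + b n) \<longlonglongrightarrow> x0"
      using tendsto_add[OF x b0] by simp
    ultimately have "\<forall>\<^sub>F n in sequentially. set_inverse S (x n + b n) \<subseteq> set_inverse S x0"
      by (rule eventually_compose_filterlim)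
    then obtain N where N: "\<And>n. n \<ge> N \<Longrightarrow> set_inverse S (x n + b n) \<subseteq> set_inverse S x0"
      unfolding eventually_sequentially by blast
    \<comment> \<open>The points \<open>z n\<close> eventually lie in the polyhedron of all points that have \<open>x0\<close> as a
      subgradient, so their limit direction is tangent to it, hence feasible.\<close>
    have "z n \<in> set_inverse S x0" if "n \<ge> N" for n
      using N[OF that] b[of n] by (auto simp: set_inverse_def)
    then have "z0 + t (n + N) *\<^sub>R ((z (n + N) - z0) /\<^sub>R t (n + N)) \<in> set_inverse S x0" for n
      using less_imp_neq[OF t[of "n + N"]] by simp
    then have "- adjoint A d \<in> tangent_cone (set_inverse S x0) z0"
      using t LIMSEQ_ignore_initial_segment[OF t0, of N] LIMSEQ_ignore_initial_segment[OF zd, of N]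
      unfolding tangent_cone_def
      by (intro CollectI exI[of _ "\<lambda>n. t (n + N)"]
          exI[of _ "\<lambda>n. (z (n + N) - z0) /\<^sub>R t (n + N)"] conjI allI)
    then have "\<forall>\<^sub>F s in at_right 0. z0 + s *\<^sub>R (- adjoint A d) \<in> set_inverse S x0"
      using stable_inv x0
      by (intro polyhedron_tangent_direction_feasible) (auto simp: outer_stable_def set_inverse_def)
    then show ?thesis by (simp add: set_inverse_def)
  qed
  obtain D where D: "has_dir_deriv F y0 d D" using dirdiff by blast
  have "(\<lambda>n. (F (y0 + t n *\<^sub>R w n) - F y0) /\<^sub>R t n) \<longlonglongrightarrow> D"
    by (rule tendsto_quotient_of_lipschitz[OF lip \<epsilon> D t t0 w])
  moreover have "y0 + t n *\<^sub>R w n = y n" for n using t[of n] by (simp add: w_def)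
  ultimately have "(\<lambda>n. (F (y n) - F y0) /\<^sub>R t n) \<longlonglongrightarrow> D" by simp
  with w have lim: "(\<lambda>n. w n \<bullet> ((F (y n) - F y0) /\<^sub>R t n)) \<longlonglongrightarrow> d \<bullet> D"
    by (intro tendsto_inner)
  obtain K where K: "K > 0" "\<And>v. norm (adjoint A v) \<le> norm v * K"
    using B.pos_bounded by blast
  obtain \<kappa> where \<kappa>: "\<kappa> \<ge> 0" "\<forall>\<^sub>F z in nhds z0. \<forall>y x a b. y \<in> ball y0 \<epsilon> \<longrightarrow> F y = A x + a \<longrightarrow>
      x + b \<in> S z \<longrightarrow>
      (\<exists>p\<in>S z0. A p = F y0 \<and> norm (x - p) \<le> \<kappa> * (norm (y - y0) + norm a + norm b))"
    using multiplier_bound by blast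
  define C where "C = 2 * \<kappa> + K + 2"
  have "\<forall>\<^sub>F n in sequentially. y n \<in> ball y0 \<epsilon>"
    using y \<epsilon> by (auto dest: topological_tendstoD[where S="ball y0 \<epsilon>"])
  with eventually_compose_filterlim[OF \<kappa>(2) z]
  have "\<forall>\<^sub>F n in sequentially. w n \<bullet> ((F (y n) - F y0) /\<^sub>R t n) \<le> C * (\<rho> n / t n)"
  proof eventually_elim
    case (elim n)
    then obtain p where p: "p \<in> S z0" "A p = F y0"
      "norm (x n - p) \<le> \<kappa> * (norm (y n - y0) + norm (a n) + norm (b n))"
      using F[of n] b[of n] by blast
    have "norm (x n - p) \<le> \<kappa> * (t n + t n)"
      using p(3) bounds(4)[of n] \<rho>t[of n] \<kappa>(1) unfolding t_def
      by (elim order_trans) (intro mult_left_mono, auto)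
    moreover have "norm (z n - z0) \<le> (1 + K) * t n"
    proof -
      have "z n - z0 = e n - adjoint A (y n - y0)" by (simp add: e_def)
      then have "norm (z n - z0) \<le> norm (e n) + norm (adjoint A (y n - y0))"
        by (simp add: norm_triangle_ineq4)
      then show ?thesis
        using bounds(3)[of n] \<rho>t[of n] K(2)[of "y n - y0"] by (simp add: t_def algebra_simps)
    qed
    ultimately have "norm (x n - p) * norm (e n) + norm (b n) * norm (z n - z0) + norm (a n) * t n
      \<le> (\<kappa> * (t n + t n)) * \<rho> n + \<rho> n * ((1 + K) * t n) + \<rho> n * t n"
      using bounds[of n] \<kappa>(1) t[of n] \<rho>0[of n] by (intro add_mono mult_mono) auto
    also have "\<dots> = C * (\<rho> n * t n)" by (simp add: C_def algebra_simps)
    finally have "(F (y n) - F y0) \<bullet> (y n - y0) \<le> C * (\<rho> n * t n)"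
      using monotonicity_gap[OF F[of n] b[of n] p(1,2), where e = "e n"] by (simp add: t_def e_def)
    then have "(F (y n) - F y0) \<bullet> (y n - y0) / (t n * t n) \<le> C * (\<rho> n * t n) / (t n * t n)"
      by (rule divide_right_mono) simp
    moreover have "C * (\<rho> n * t n) / (t n * t n) = C * (\<rho> n / t n)"
      using t[of n] by simp
    moreover have "w n \<bullet> ((F (y n) - F y0) /\<^sub>R t n) = (F (y n) - F y0) \<bullet> (y n - y0) / (t n * t n)"
      by (simp add: w_def inner_commute[of "y n - y0"] divide_inverse mult.commute)
    ultimately show ?case by simp
  qed
  moreover have "(\<lambda>n. C * (\<rho> n / t n)) \<longlonglongrightarrow> 0"
    using tendsto_mult_right_zero[OF quot0] .
  ultimately have "d \<bullet> D \<le> 0"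
    using lim by (intro tendsto_le[OF trivial_limit_sequentially]) auto
  moreover have "0 < d \<bullet> D"
    using \<open>norm d = 1\<close> by (intro second_order[OF _ feasible D]) auto
  ultimately show False by simp
qed

text \<open>
  Local Lipschitz dependence of \<open>y\<close> on the residual, by extracting from a failing family of
  constants a sequence as excluded above.
\<close>

lemma primal_bound:
  "\<exists>\<kappa>>0. \<exists>\<delta>>0. \<forall>y z x a b. dist y y0 < \<delta> \<longrightarrow> dist z z0 < \<delta> \<longrightarrow> dist x x0 < \<delta> \<longrightarrow>
     F y = A x + a \<longrightarrow> x + b \<in> S z \<longrightarrow> norm (y - y0) \<le> \<kappa> * residual a b y z"
proof (rule ccontr)
  assume neg: "\<not> ?thesis"
  \<comment> \<open>The index serves both as the constant and as the inverse radius. Being bad for \<open>n\<close> implies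
    being bad for smaller indices, so passing to a subsequence preserves all estimates.\<close>
  define bad where "bad n q \<longleftrightarrow> (case q of (y, z, x, a, b) \<Rightarrow>
     dist y y0 < inverse (real (Suc n)) \<and> dist z z0 < inverse (real (Suc n)) \<and>
     dist x x0 < inverse (real (Suc n)) \<and> F y = A x + a \<and> x + b \<in> S z \<and>
     real (Suc n) * residual a b y z < norm (y - y0))" for n q
  have bad_mono: "bad m q" if "bad n q" "m \<le> n" for m n q
  proof -
    have "inverse (real (Suc n)) \<le> inverse (real (Suc m))"
      using that(2) by (intro le_imp_inverse_le) auto
    moreover obtain y z x a b where q: "q = (y, z, x, a, b)" by (cases q) auto
    moreover have "real (Suc m) * residual a b y z \<le> real (Suc n) * residual a b y z"
      using that(2) by (intro mult_right_mono) (auto simp: residual_def)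
    ultimately show ?thesis
      using that(1) unfolding bad_def q prod.case by (elim conjE, intro conjI) (assumption | linarith)+
  qed
  have "\<exists>q. bad n q" for n
  proof (rule ccontr)
    assume nb: "\<nexists>q. bad n q"
    have "\<forall>y z x a b. dist y y0 < inverse (real (Suc n)) \<longrightarrow> dist z z0 < inverse (real (Suc n)) \<longrightarrow>
      dist x x0 < inverse (real (Suc n)) \<longrightarrow> F y = A x + a \<longrightarrow> x + b \<in> S z \<longrightarrow>
      norm (y - y0) \<le> real (Suc n) * residual a b y z"
    proof (intro allI impI)
      fix y z x a b
      assume "dist y y0 < inverse (real (Suc n))" "dist z z0 < inverse (real (Suc n))"
        "dist x x0 < inverse (real (Suc n))" "F y = A x + a" "x + b \<in> S z"
      moreover have "\<not> bad n (y, z, x, a, b)" using nb by blast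
      ultimately show "norm (y - y0) \<le> real (Suc n) * residual a b y z"
        by (simp add: bad_def not_less)
    qed
    moreover have "real (Suc n) > 0" "inverse (real (Suc n)) > 0" by simp_all
    ultimately show False using neg by blast
  qed
  then obtain q where q: "\<And>n. bad n (q n)" by metis
  define dir where "dir n = (fst (q n) - y0) /\<^sub>R norm (fst (q n) - y0)" for n
  have "dir n \<in> sphere 0 1" for n
  proof -
    have "0 < norm (fst (q n) - y0)"
      using q[of n] residual_nonneg
      by (auto simp: bad_def mult_less_0_iff not_less[symmetric] split: prod.splits)
    then show ?thesis by (simp add: dir_def)
  qed
  then obtain d \<phi> where \<phi>: "strict_mono \<phi>" "(dir \<circ> \<phi>) \<longlonglongrightarrow> d"
    using compact_imp_seq_compact[OF compact_sphere] unfolding seq_compact_def by metis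
  define y where "y n = fst (q (\<phi> n))" for n
  define z where "z n = fst (snd (q (\<phi> n)))" for n
  define x where "x n = fst (snd (snd (q (\<phi> n))))" for n
  define a where "a n = fst (snd (snd (snd (q (\<phi> n)))))" for n
  define b where "b n = snd (snd (snd (snd (q (\<phi> n)))))" for n
  have "bad n (y n, z n, x n, a n, b n)" for n
    using bad_mono[OF q seq_suble[OF \<phi>(1), of n]] by (simp add: y_def z_def x_def a_def b_def)
  then have seq: "dist (y n) y0 < inverse (real (Suc n))" "dist (z n) z0 < inverse (real (Suc n))"
     "dist (x n) x0 < inverse (real (Suc n))" "F (y n) = A (x n) + a n" "x n + b n \<in> S (z n)"
     "real (Suc n) * residual (a n) (b n) (y n) (z n) < norm (y n - y0)" for n
    by (simp_all add: bad_def)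
  have conv: "u \<longlonglongrightarrow> l" if "\<And>n. dist (u n) l < inverse (real (Suc n))" for u :: "nat \<Rightarrow> 'c::metric_space" and l
    using that by (intro metric_tendsto_imp_tendsto[OF LIMSEQ_inverse_real_of_nat])
      (auto intro!: always_eventually less_imp_le)
  have "(\<lambda>n. (y n - y0) /\<^sub>R norm (y n - y0)) \<longlonglongrightarrow> d"
    using \<phi>(2) by (simp add: dir_def y_def o_def)
  from no_sublinear_sequence[OF conv[OF seq(1)] conv[OF seq(2)] conv[OF seq(3)] seq(4-6) this]
  show False .
qed

text \<open>
  The bound for \<open>y\<close> passes to \<open>z\<close> through the linear constraint and then, by the multiplier bound, to
  the distance of \<open>x\<close> from the multiplier set. So the distance is measured to solutions of the form
  \<open>(y0, z0, p)\<close>.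
\<close>

lemma primal_dual_bound:
  "\<exists>\<kappa>>0. \<exists>\<delta>>0. \<forall>y z x a b. dist y y0 < \<delta> \<longrightarrow> dist z z0 < \<delta> \<longrightarrow> dist x x0 < \<delta> \<longrightarrow>
     F y = A x + a \<longrightarrow> x + b \<in> S z \<longrightarrow>
     (\<exists>p\<in>S z0. A p = F y0 \<and> dist (y, z, x) (y0, z0, p) \<le> \<kappa> * residual a b y z)"
proof -
  obtain \<kappa>1 where \<kappa>1: "\<kappa>1 \<ge> 0" "\<forall>\<^sub>F z in nhds z0. \<forall>y x a b. y \<in> ball y0 \<epsilon> \<longrightarrow> F y = A x + a \<longrightarrow>
      x + b \<in> S z \<longrightarrow>
      (\<exists>p\<in>S z0. A p = F y0 \<and> norm (x - p) \<le> \<kappa>1 * (norm (y - y0) + norm a + norm b))"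
    using multiplier_bound by blast
  then obtain \<delta>1 where \<delta>1: "\<delta>1 > 0" "\<And>z y x a b. dist z z0 < \<delta>1 \<Longrightarrow> y \<in> ball y0 \<epsilon> \<Longrightarrow> F y = A x + a \<Longrightarrow>
      x + b \<in> S z \<Longrightarrow>
      (\<exists>p\<in>S z0. A p = F y0 \<and> norm (x - p) \<le> \<kappa>1 * (norm (y - y0) + norm a + norm b))"
    unfolding eventually_nhds_metric by blast
  obtain \<kappa>2 \<delta>2 where \<kappa>2: "\<kappa>2 > 0" "\<delta>2 > 0"
    "\<And>y z x a b. dist y y0 < \<delta>2 \<Longrightarrow> dist z z0 < \<delta>2 \<Longrightarrow> dist x x0 < \<delta>2 \<Longrightarrow>
     F y = A x + a \<Longrightarrow> x + b \<in> S z \<Longrightarrow> norm (y - y0) \<le> \<kappa>2 * residual a b y z"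
    using primal_bound by blast
  interpret B: bounded_linear "adjoint A"
    using adjoint_linear[OF A] by (simp add: linear_conv_bounded_linear)
  obtain K where K: "K > 0" "\<And>v. norm (adjoint A v) \<le> norm v * K"
    using B.pos_bounded by blast
  define \<kappa> where "\<kappa> = \<kappa>2 + (1 + \<kappa>2 * K) + \<kappa>1 * (\<kappa>2 + 1)"
  have "\<kappa> > 0" unfolding \<kappa>_def using \<kappa>1 \<kappa>2 K by (intro add_pos_nonneg) auto
  moreover have "\<exists>p\<in>S z0. A p = F y0 \<and> dist (y, z, x) (y0, z0, p) \<le> \<kappa> * residual a b y z"
    if near: "dist y y0 < min \<epsilon> (min \<delta>1 \<delta>2)" "dist z z0 < min \<epsilon> (min \<delta>1 \<delta>2)"
      "dist x x0 < min \<epsilon> (min \<delta>1 \<delta>2)" and F: "F y = A x + a" and b: "x + b \<in> S z" for y z x a b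
  proof -
    define \<rho> where "\<rho> = residual a b y z"
    have y: "norm (y - y0) \<le> \<kappa>2 * \<rho>"
      unfolding \<rho>_def using near by (intro \<kappa>2(3)[OF _ _ _ F b]) auto
    obtain p where p: "p \<in> S z0" "A p = F y0"
      "norm (x - p) \<le> \<kappa>1 * (norm (y - y0) + norm a + norm b)"
      using \<delta>1(2)[OF _ _ F b] near by (auto simp: dist_commute)
    have "norm (y - y0) + norm a + norm b \<le> (\<kappa>2 + 1) * \<rho>"
    proof -
      have "norm a + norm b \<le> \<rho>" by (simp add: \<rho>_def residual_def)
      then show ?thesis using y by (simp add: algebra_simps)
    qed
    then have "\<kappa>1 * (norm (y - y0) + norm a + norm b) \<le> \<kappa>1 * ((\<kappa>2 + 1) * \<rho>)"
      using \<kappa>1(1) by (rule mult_left_mono)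
    then have x: "norm (x - p) \<le> \<kappa>1 * (\<kappa>2 + 1) * \<rho>" using p(3) by simp
    define e where "e = adjoint A (y - y0) + (z - z0)"
    have "norm (z - z0) = norm (e - adjoint A (y - y0))" by (simp add: e_def)
    also have "\<dots> \<le> norm e + norm (y - y0) * K"
      using norm_triangle_ineq4[of e "adjoint A (y - y0)"] K(2)[of "y - y0"] by linarith
    also have "\<dots> \<le> \<rho> + (\<kappa>2 * \<rho>) * K"
      using y K(1) by (intro add_mono mult_right_mono) (auto simp: e_def \<rho>_def residual_def)
    finally have z: "norm (z - z0) \<le> (1 + \<kappa>2 * K) * \<rho>" by (simp add: algebra_simps)
    have "dist (y, z, x) (y0, z0, p) = norm (y - y0, z - z0, x - p)" by (simp add: dist_norm)
    also have "\<dots> \<le> norm (y - y0) + (norm (z - z0) + norm (x - p))"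
      using norm_Pair_le[of "y - y0" "(z - z0, x - p)"] norm_Pair_le[of "z - z0" "x - p"] by linarith
    also have "\<dots> \<le> \<kappa> * \<rho>"
      using x y z by (simp add: \<kappa>_def distrib_right)
    finally show ?thesis using p unfolding \<rho>_def by blast
  qed
  moreover have "min \<epsilon> (min \<delta>1 \<delta>2) > 0" using \<epsilon> \<delta>1 \<kappa>2 by simp
  ultimately show ?thesis by blast
qed

end

section \<open>Subgradients and directional derivatives\<close>

lemma has_dir_deriv_imp_dir_deriv:
  assumes "has_dir_deriv F x d D"
  shows "dir_deriv F x d = D"
  unfolding dir_deriv_def
proof (rule the_equality)
  show "has_dir_deriv F x d D" by fact
  show "E = D" if "has_dir_deriv F x d E" for E
    using tendsto_unique[OF trivial_limit_at_right_real] that assms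
    unfolding has_dir_deriv_def by blast
qed

lemma subdifferential_eq_egrad:
  fixes f :: "'a::euclidean_space \<Rightarrow> ereal"
  assumes f: "eproper f" and x: "x \<in> interior (edom f)"
    and diff: "(\<lambda>u. real_of_ereal (f u)) differentiable (at x)"
    and v: "v \<in> subdifferential f x"
  shows "v = egrad f x"
proof -
  let ?g = "\<lambda>u. real_of_ereal (f u) - u \<bullet> v"
  have fin: "f u = ereal (real_of_ereal (f u))" if "u \<in> edom f" for u
    using eproper_finite[OF f that] by auto
  have "((\<lambda>u. real_of_ereal (f u)) has_derivative (\<lambda>h. h \<bullet> egrad f x)) (at x)"
    using GDERIV_egrad[OF diff] by (simp add: gderiv_def)
  then have deriv: "(?g has_derivative (\<lambda>h. h \<bullet> egrad f x - h \<bullet> v)) (at x)"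
    by (auto intro!: derivative_eq_intros)
  have "?g x \<le> ?g u" if "u \<in> interior (edom f)" for u
  proof -
    have "f x + ereal (v \<bullet> (u - x)) \<le> f u" using v by (simp add: subdifferential_def)
    moreover have "x \<in> edom f" "u \<in> edom f" using x that interior_subset by auto
    ultimately have "real_of_ereal (f x) + v \<bullet> (u - x) \<le> real_of_ereal (f u)"
      using fin by (metis ereal_less_eq(3) plus_ereal.simps(1))
    then show ?thesis by (simp add: inner_diff_right inner_commute)
  qed
  then have "\<forall>y\<in>interior (edom f). ?g x \<le> ?g y" by blast
  then have "(\<lambda>h. h \<bullet> egrad f x - h \<bullet> v) = (\<lambda>h. 0)"
    using differential_zero_maxmin[OF x open_interior deriv] by blast
  then have "(egrad f x - v) \<bullet> egrad f x - (egrad f x - v) \<bullet> v = 0" by metis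
  then have "(egrad f x - v) \<bullet> (egrad f x - v) = 0" by (simp add: inner_diff_right)
  then show ?thesis by simp
qed

lemma subdifferential_monotone:
  assumes f: "eproper f" and "x \<in> subdifferential f z" "x' \<in> subdifferential f z'"
  shows "0 \<le> (x - x') \<bullet> (z - z')"
proof -
  obtain r s where "f z = ereal r" "f z' = ereal s"
    using eproper_finite[OF f subdifferential_dom[OF f]] assms(2,3) by metis
  moreover have "f z + ereal (x \<bullet> (z' - z)) \<le> f z'" "f z' + ereal (x' \<bullet> (z - z')) \<le> f z"
    using assms(2,3) by (simp_all add: subdifferential_def)
  ultimately show ?thesis by (simp add: inner_diff_left inner_diff_right)
qed

text \<open>
  A common subgradient at both ends of a segment makes the function affine with that slope
  between these ends.
\<close>

lemma edir_deriv_along_subgradient: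
  assumes f: "eproper f" and x: "x \<in> subdifferential f z"
    and ray: "\<forall>\<^sub>F t in at_right 0. x \<in> subdifferential f (z + t *\<^sub>R d)"
  shows "edir_deriv f z d = ereal (x \<bullet> d)"
proof -
  have "\<forall>\<^sub>F t in at_right 0. ereal (x \<bullet> d) = (f (z + t *\<^sub>R d) - f z) / ereal t"
    using ray eventually_at_right_less[of 0]
  proof eventually_elim
    case (elim t)
    obtain r s where rs: "f z = ereal r" "f (z + t *\<^sub>R d) = ereal s"
      using eproper_finite[OF f subdifferential_dom[OF f]] x elim(1) by metis
    have "f z + ereal (x \<bullet> ((z + t *\<^sub>R d) - z)) \<le> f (z + t *\<^sub>R d)"
      "f (z + t *\<^sub>R d) + ereal (x \<bullet> (z - (z + t *\<^sub>R d))) \<le> f z"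
      using x elim(1) unfolding subdifferential_def by blast+
    then have "s - r = t * (x \<bullet> d)" using rs by simp
    then show ?case using rs elim(2) by simp
  qed
  then have "((\<lambda>t. (f (z + t *\<^sub>R d) - f z) / ereal t) \<longlongrightarrow> ereal (x \<bullet> d)) (at_right 0)"
    by (rule Lim_transform_eventually[OF tendsto_const])
  then show ?thesis
    unfolding edir_deriv_def by (intro tendsto_Lim) auto
qed

lemma tangent_cone_if_eventually_feasible:
  assumes "\<forall>\<^sub>F t in at_right 0. z + t *\<^sub>R d \<in> C"
  shows "d \<in> tangent_cone C z"
proof -
  obtain \<delta> where \<delta>: "\<delta> > 0" "\<And>t. 0 < t \<Longrightarrow> t < \<delta> \<Longrightarrow> z + t *\<^sub>R d \<in> C"
    using assms by (auto simp: eventually_at_right_field)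
  define t where "t k = (\<delta> / 2) * inverse (real (Suc k))" for k
  have "t \<longlonglongrightarrow> (\<delta> / 2) * 0"
    unfolding t_def by (intro tendsto_intros LIMSEQ_inverse_real_of_nat)
  moreover have t: "0 < t k" "t k < \<delta>" for k
  proof -
    show "0 < t k" using \<delta>(1) by (simp add: t_def)
    have "inverse (real (Suc k)) \<le> 1" by (simp add: inverse_le_1_iff)
    then have "t k \<le> (\<delta> / 2) * 1" using \<delta>(1) unfolding t_def by (intro mult_left_mono) auto
    then show "t k < \<delta>" using \<delta>(1) by linarith
  qed
  ultimately show ?thesis
    unfolding tangent_cone_def using \<delta>(2)[OF t]
    by (intro CollectI exI[of _ t] exI[of _ "\<lambda>_. d"]) auto
qed

section \<open>Metric subregularity of the Lagrangian map\<close>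

text \<open>
  A pointwise bound over the values of \<open>F u\<close> suffices, and \<open>V\<close> can be the whole space. Positivity of
  \<open>\<kappa>\<close> matters where \<open>F u\<close> is empty: the right-hand side is then \<open>\<infinity>\<close> rather than \<open>0 * \<infinity> = 0\<close>.
\<close>

lemma metrically_subregularI:
  assumes "vbar \<in> F ubar" "0 < \<kappa>" "0 < \<delta>"
    and bound: "\<And>u v. dist u ubar < \<delta> \<Longrightarrow> v \<in> F u \<Longrightarrow>
      \<exists>w\<in>set_inverse F vbar. dist u w \<le> \<kappa> * dist vbar v"
  shows "metrically_subregular F ubar vbar \<kappa>"
proof -
  have "esetdist u (set_inverse F vbar) \<le> ereal \<kappa> * esetdist vbar (F u \<inter> UNIV)"
    if u: "u \<in> ball ubar \<delta>" for u
  proof -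
    have "esetdist u (set_inverse F vbar) / ereal \<kappa> \<le> ereal (dist vbar v)" if v: "v \<in> F u" for v
    proof -
      obtain w where w: "w \<in> set_inverse F vbar" "dist u w \<le> \<kappa> * dist vbar v"
        using bound[OF _ v] u by (auto simp: dist_commute)
      have "esetdist u (set_inverse F vbar) \<le> ereal (dist u w)"
        unfolding esetdist_def using w(1) by (rule INF_lower)
      also have "\<dots> \<le> ereal \<kappa> * ereal (dist vbar v)" using w(2) by simp
      finally show ?thesis using \<open>0 < \<kappa>\<close> by (subst ereal_divide_le_pos) auto
    qed
    then have "esetdist u (set_inverse F vbar) / ereal \<kappa> \<le> esetdist vbar (F u \<inter> UNIV)"
      unfolding esetdist_def by (intro INF_greatest) auto
    then show ?thesis using \<open>0 < \<kappa>\<close> by (subst (asm) ereal_divide_le_pos) auto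
  qed
  then show ?thesis
    unfolding metrically_subregular_def using assms(1-3)
    by (intro conjI exI[of _ "ball ubar \<delta>"] exI[of _ UNIV]) auto
qed

theorem theorem1:
  fixes A :: "'x::euclidean_space \<Rightarrow> 'y::euclidean_space"
    and c :: 'x
    and h :: "'y \<Rightarrow> real"
    and p :: "'x \<Rightarrow> ereal"
    and hs :: "'y \<Rightarrow> ereal"
    and ps :: "'x \<Rightarrow> ereal"
    and xbar :: 'x and ybar :: 'y and zbar :: 'x
  defines "hs \<equiv> fenchel_conjugate (\<lambda>y. ereal (h y))"
    and "ps \<equiv> fenchel_conjugate p"
  assumes "linear A"
    and "closed_proper_convex (\<lambda>y. ereal (h y))"
    and "closed_proper_convex p"
    and "essentially_smooth hs"
    and "locally_lipschitz_on (interior (edom hs)) (egrad hs)"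
    and "dir_differentiable_on (egrad hs) (interior (edom hs))"
    and "\<exists>P. P \<noteq> {} \<and> polyhedron P \<and> (ps = indicator_fn P \<or> ps = support_fn P)"
    and "kkt_point hs ps A c xbar ybar zbar"
    and "second_order_sufficient hs ps A c ybar zbar"
  shows "\<exists>\<kappa>\<ge>0. metrically_subregular (lagrangian_map hs ps A c) (ybar, zbar, xbar) 0 \<kappa>"
proof -
  note A = \<open>linear A\<close>
  obtain P where P: "P \<noteq> {}" "polyhedron P" "ps = indicator_fn P \<or> ps = support_fn P"
    using assms(9) by blast
  have ps: "eproper ps" using P eproper_indicator_fn eproper_support_fn by blast
  have "subdifferential ps = set_inverse (maximizers P) \<or> subdifferential ps = maximizers P"
    using P subdifferential_indicator_fn subdifferential_support_fn
      polyhedron_imp_closed polyhedron_imp_convex by metis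
  then have stable: "outer_stable (subdifferential ps)" "outer_stable (set_inverse (subdifferential ps))"
    using outer_stable_maximizers[OF P(2)] outer_stable_normal_cone[OF P(2)] by auto
  have pc: "proper_convex hs" and hs: "eproper hs"
    and diff: "\<And>y. y \<in> interior (edom hs) \<Longrightarrow> (\<lambda>u. real_of_ereal (hs u)) differentiable (at y)"
    using assms(6) by (auto simp: essentially_smooth_def proper_convex_def)
  have kkt: "ybar \<in> interior (edom hs)" "egrad hs ybar = A xbar"
    "xbar \<in> subdifferential ps zbar" "adjoint A ybar + zbar = c"
    using assms(10) by (auto simp: kkt_point_def)
  obtain e1 L where e1: "e1 > 0" "L-lipschitz_on (ball ybar e1 \<inter> interior (edom hs)) (egrad hs)"
    using assms(7) kkt(1) by (auto simp: locally_lipschitz_on_def)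
  obtain e2 where e2: "e2 > 0" "ball ybar e2 \<subseteq> interior (edom hs)"
    using kkt(1) open_interior open_contains_ball by metis
  define \<eta> where "\<eta> = min e1 e2"
  have \<eta>: "\<eta> > 0" "ball ybar \<eta> \<subseteq> interior (edom hs)"
    using e1(1) e2 by (auto simp: \<eta>_def)
  interpret B: linear "adjoint A" by (rule adjoint_linear[OF A])
  interpret second_order_kkt A "egrad hs" "subdifferential ps" ybar zbar xbar L \<eta>
  proof (rule second_order_kkt.intro)
    show "linear A" "0 < \<eta>" "outer_stable (subdifferential ps)"
      "outer_stable (set_inverse (subdifferential ps))" "xbar \<in> subdifferential ps zbar"
      "egrad hs ybar = A xbar" by fact+
    show "L-lipschitz_on (ball ybar \<eta>) (egrad hs)"
      using e1(2) by (rule lipschitz_on_subset) (use \<eta> in \<open>auto simp: \<eta>_def\<close>)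
    show "\<exists>D. has_dir_deriv (egrad hs) ybar d D" for d
      using assms(8) kkt(1) by (simp add: dir_differentiable_on_def)
    show "0 \<le> (x - x') \<bullet> (z - z')"
      if "x \<in> subdifferential ps z" "x' \<in> subdifferential ps z'" for x z x' z'
      using subdifferential_monotone[OF ps that] .
    show "0 < d \<bullet> D" if d: "d \<noteq> 0"
      and ray: "\<forall>\<^sub>F t in at_right 0. xbar \<in> subdifferential ps (zbar - t *\<^sub>R adjoint A d)"
      and D: "has_dir_deriv (egrad hs) ybar d D" for d D
    proof -
      \<comment> \<open>The ray condition makes \<open>(d, - adjoint A d)\<close> a critical direction: it gives tangency to the
        domain, and it makes \<open>ps\<close> affine along the ray near \<open>zbar\<close> with slope \<open>xbar \<bullet> (- adjoint A d)\<close>, which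
        cancels \<open>egrad hs ybar \<bullet> d = A xbar \<bullet> d\<close>.\<close>
      have ray': "\<forall>\<^sub>F t in at_right 0. xbar \<in> subdifferential ps (zbar + t *\<^sub>R (- adjoint A d))"
        using ray by simp
      then have "\<forall>\<^sub>F t in at_right 0. zbar + t *\<^sub>R (- adjoint A d) \<in> edom ps"
        by eventually_elim (rule subdifferential_dom[OF ps])
      then have "- adjoint A d \<in> tangent_cone (edom ps) zbar"
        by (rule tangent_cone_if_eventually_feasible)
      moreover have "edir_deriv ps zbar (- adjoint A d) = ereal (xbar \<bullet> (- adjoint A d))"
        by (rule edir_deriv_along_subgradient[OF ps kkt(3) ray'])
      ultimately have "(d, - adjoint A d) \<in> critical_cone hs ps A ybar zbar"
        by (simp add: critical_cone_def kkt(2) adjoint_works[OF A])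
      then have "d \<bullet> dir_deriv (egrad hs) ybar d > 0"
        using assms(11) d by (auto simp: second_order_sufficient_def zero_prod_def)
      then show ?thesis using has_dir_deriv_imp_dir_deriv[OF D] by simp
    qed
  qed
  obtain \<kappa> \<delta> where \<kappa>: "\<kappa> > 0" "\<delta> > 0"
    "\<And>y z x a b. dist y ybar < \<delta> \<Longrightarrow> dist z zbar < \<delta> \<Longrightarrow> dist x xbar < \<delta> \<Longrightarrow>
      egrad hs y = A x + a \<Longrightarrow> x + b \<in> subdifferential ps z \<Longrightarrow>
      \<exists>p\<in>subdifferential ps zbar. A p = egrad hs ybar \<and>
        dist (y, z, x) (ybar, zbar, p) \<le> \<kappa> * residual a b y z"
    using primal_dual_bound by blast
  have grad: "subdifferential hs y = {egrad hs y}" if "y \<in> interior (edom hs)" for y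
    using egrad_subdifferential[OF pc that diff[OF that]]
      subdifferential_eq_egrad[OF hs that diff[OF that]] by blast
  have zero: "0 \<in> lagrangian_map hs ps A c (ybar, zbar, q)"
    if "q \<in> subdifferential ps zbar" "A q = egrad hs ybar" for q
    unfolding lagrangian_map_explicit[OF hs ps A] using that kkt(1,4)
    by (auto simp: zero_prod_def grad intro!: image_eqI[where x=q])
  have "\<exists>w\<in>set_inverse (lagrangian_map hs ps A c) 0. dist (y, z, x) w \<le> 3 * \<kappa> * dist 0 v"
    if near: "dist (y, z, x) (ybar, zbar, xbar) < min \<eta> \<delta>"
      and v: "v \<in> lagrangian_map hs ps A c (y, z, x)" for y z x v
  proof -
    obtain a b e where abe: "v = (a, b, e)" by (cases v) auto
    have d1: "dist y ybar < min \<eta> \<delta>" "dist (z, x) (zbar, xbar) < min \<eta> \<delta>"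
      using dist_fst_le[of "(y, z, x)" "(ybar, zbar, xbar)"]
        dist_snd_le[of "(y, z, x)" "(ybar, zbar, xbar)"] near by auto
    have d2: "dist z zbar < min \<eta> \<delta>" "dist x xbar < min \<eta> \<delta>"
      using dist_fst_le[of "(z, x)" "(zbar, xbar)"] dist_snd_le[of "(z, x)" "(zbar, xbar)"] d1(2)
      by auto
    have "y \<in> interior (edom hs)" using d1(1) \<eta>(2) by (auto simp: dist_commute)
    then have eqs: "egrad hs y = A x + a" "x + b \<in> subdifferential ps z" "e = adjoint A y + z - c"
      using v unfolding lagrangian_map_explicit[OF hs ps A] abe by (auto simp: grad)
    obtain q where q: "q \<in> subdifferential ps zbar" "A q = egrad hs ybar"
      "dist (y, z, x) (ybar, zbar, q) \<le> \<kappa> * residual a b y z"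
      using \<kappa>(3)[OF _ _ _ eqs(1,2)] d1(1) d2 by auto
    \<comment> \<open>Each of the three summands of the residual is at most \<open>norm v\<close>, whence the factor \<open>3\<close>.\<close>
    have "adjoint A (y - ybar) + (z - zbar) = e"
      using kkt(4) by (simp add: eqs(3) B.diff algebra_simps)
    then have "residual a b y z = norm a + norm b + norm e" by (simp add: residual_def)
    moreover have "norm a \<le> norm v" "norm (b, e) \<le> norm v"
      using norm_fst_le[of a "(b, e)"] norm_snd_le[of "(b, e)" a] by (simp_all add: abe)
    moreover have "norm b \<le> norm (b, e)" "norm e \<le> norm (b, e)"
      using norm_fst_le[of b e] norm_snd_le[of e b] by simp_all
    ultimately have "residual a b y z \<le> 3 * norm v" by linarith
    then have "\<kappa> * residual a b y z \<le> \<kappa> * (3 * norm v)"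
      using \<kappa>(1) by (intro mult_left_mono) auto
    then have "dist (y, z, x) (ybar, zbar, q) \<le> 3 * \<kappa> * dist 0 v"
      using q(3) by (simp add: algebra_simps)
    moreover have "(ybar, zbar, q) \<in> set_inverse (lagrangian_map hs ps A c) 0"
      using zero[OF q(1,2)] by (simp add: set_inverse_def)
    ultimately show ?thesis by blast
  qed
  then have "metrically_subregular (lagrangian_map hs ps A c) (ybar, zbar, xbar) 0 (3 * \<kappa>)"
    using zero[OF kkt(3)] kkt(2) \<kappa>(1,2) \<eta>(1)
    by (intro metrically_subregularI[where \<delta> = "min \<eta> \<delta>"]) auto
  then show ?thesis using \<kappa>(1) by (intro exI[of _ "3 * \<kappa>"]) auto
qed

end
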